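(* Let $S_1,\dots,S_n$ be finite subsets of $R$, $\Lambda$ a finite set, and $(\varepsilon(i,u,\lambda)\mid i\in[1,n],u\in S_i,\lambda\in\Lambda)$ natural numbers. Define $g(\lambda)=\prod_{i=1}^n\prod_{u\in S_i}(x_i-u)^{\varepsilon(i,u,\lambda)}$, $\theta(\lambda)=(\sum_{u\in S_1}\varepsilon(1,u,\lambda),\dots,\sum_{u\in S_n}\varepsilon(n,u,\lambda))$, $D=\{\theta(\lambda)\mid\lambda\in\Lambda\}$, and for $a\in\prod_iS_i$, $B_a=\{(\varepsilon(1,a_1,\lambda),\dots,\varepsilon(n,a_n,\lambda))\mid\lambda\in\Lambda\}$, and $$Q=\{f\in\Omega:\ \mathrm{supp}(f(x_1+a_1,\dots,x_n+a_n))\subseteq\nabla(B_a)\text{ for all }a\in\textstyle\prod_{i=1}^nS_i\}.$$ Assume $\mathbb{N}^n\setminus\nabla(D)$ is finite, and put $\zeta_2=|\mathbb{N}^n\setminus\nabla(D)|$ and $\zeta_1=\sum_{a\in\prod_iS_i}|\mathbb{N}^n\setminus\nabla(B_a)|$. (Then each $g(\lambda)$ is monic with greatest support element $\theta(\lambda)$, and $g(\lambda)\in Q$.) Then: (1) If $\zeta_1=\zeta_2$ and every $S_k$ satisfies Condition (D) in $R$, then $(g(\lambda)\mid\lambda\in\Lambda)$ is a Gröbner basis of $Q$; for every $f\in Q$ there exists $(p(\lambda)\mid\lambda\in\Lambda)\in\Omega^\Lambda$ with $f=\sum_\lambda p(\lambda)g(\lambda)$ and $\mathrm{supp}(p(\lambda))+\mathrm{supp}(g(\lambda))\subseteq\Delta(\mathrm{supp}(f))$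 for all $\lambda$; and for every $\beta\in\max(\mathrm{supp}(f))$ there exists $\lambda\in\Lambda$ with $\sum_{u\in S_k}\varepsilon(k,u,\lambda)\leqslant\beta_k$ for all $k\in[1,n]$. (2) If $\prod_iS_i\neq\emptyset$ and $\mathbf{0}\notin B_a$ for all $a\in\prod_iS_i$, then $(g(\lambda)\mid\lambda\in\Lambda)$ is a Gröbner basis of $Q$ if and only if $\zeta_1=\zeta_2$ and every $S_k$ satisfies Condition (D) in $R$.
   Context: Let $R$ be a commutative ring with identity $1_R$, $n$ a positive integer, $[1,n]=\{1,\dots,n\}$, $\mathbb{N}=\{0,1,2,\dots\}$, $\Omega=R[x_1,\dots,x_n]$, $\mathbf 0$ the zero vector. For $\alpha,\beta\in\mathbb{N}^n$, $\alpha\leqslant\beta$ means $\alpha_i\leqslant\beta_i$ for all $i$. For $f\in\Omega$, $f_{[\alpha]}$ is the coefficient of $x_1^{\alpha_1}\cdots x_n^{\alpha_n}$ and $\mathrm{supp}(f)=\{\alpha:f_{[\alpha]}\neq0\}$. For $A,B\subseteq\mathbb{N}^n$: $\Delta(A)=\{\beta:\exists\alpha\in A,\beta\leqslant\alpha\}$, $\nabla(A)=\{\beta:\exists\alpha\in A,\alpha\leqslant\beta\}$, $\max(A)=\{\beta\in A:\forall\alpha\in A,\beta\leqslant\alpha\Rightarrow\beta=\alpha\}$, $A+B=\{\alpha+\beta\}$. A polynomial $g$ is monic if $\mathrm{supp}(g)$ has a greatest element $\theta$ for $\leqslant$ and $g_{[\theta]}=1_R$. A family $(g(\lambda))_{\lambda\in\Lambda}$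 of monic polynomials with greatest support elements $\theta(\lambda)$, all in an ideal $Q$, is a Gröbner basis of $Q$ if for every $\tau\in Q\setminus\{0\}$ there are $\alpha\in\mathrm{supp}(\tau)$, $r\in\Lambda$ with $\theta(r)\leqslant\alpha$. A subset $X\subseteq R$ satisfies Condition (D) in $R$ if for all $a\neq b$ in $X$, $b-a$ is not a zero divisor of $R$. *)

theory Defs
  imports
    Main
    "HOL-Library.FuncSet"
    "HOL-Library.Function_Algebras"
    "HOL-Library.Set_Algebras"
    "HOL-Library.Poly_Mapping"
begin

text \<open>
  The index set \<open>[1,n]\<close> is the universe of a finite type \<open>'n\<close>, exponent vectors are
  functions \<open>'n \<Rightarrow> nat\<close> with the pointwise order and pointwise addition, and the polynomial
  ring \<open>R[x\<^sub>1,\<dots>,x\<^sub>n]\<close> consists of the finitely supported maps from exponent vectors to \<open>R\<close>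
  with the convolution product of \<open>Poly_Mapping\<close>. Thus \<open>Poly_Mapping.lookup f \<alpha>\<close> is the
  coefficient of the monomial with exponent \<open>\<alpha>\<close>.
\<close>

type_synonym 'n expo = "'n \<Rightarrow> nat"
type_synonym ('n, 'a) mpoly = "'n expo \<Rightarrow>\<^sub>0 'a"

abbreviation supp :: "('n, 'a::zero) mpoly \<Rightarrow> 'n expo set" where
  "supp f \<equiv> Poly_Mapping.keys f"


subsection \<open>Sets of exponent vectors\<close>

definition down_closure :: "'n expo set \<Rightarrow> 'n expo set" where
  "down_closure A = {\<beta>. \<exists>\<alpha>\<in>A. \<beta> \<le> \<alpha>}"

definition up_closure :: "'n expo set \<Rightarrow> 'n expo set" where
  "up_closure A = {\<beta>. \<exists>\<alpha>\<in>A. \<alpha> \<le> \<beta>}"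

definition max_elems :: "'n expo set \<Rightarrow> 'n expo set" where
  "max_elems A = {\<beta>\<in>A. \<forall>\<alpha>\<in>A. \<beta> \<le> \<alpha> \<longrightarrow> \<beta> = \<alpha>}"


subsection \<open>Polynomials\<close>

definition Const :: "'a \<Rightarrow> ('n, 'a::comm_ring_1) mpoly" where
  "Const c = Poly_Mapping.single 0 c"

definition Var :: "'n \<Rightarrow> ('n, 'a::comm_ring_1) mpoly" where
  "Var i = Poly_Mapping.single (\<lambda>j. if j = i then 1 else 0) 1"

text \<open>The polynomial \<open>f(x\<^sub>1 + a\<^sub>1, \<dots>, x\<^sub>n + a\<^sub>n)\<close>.\<close>

definition translate :: "('n \<Rightarrow> 'a) \<Rightarrow> ('n::finite, 'a::comm_ring_1) mpoly \<Rightarrow> ('n, 'a) mpoly" where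
  "translate a f =
     (\<Sum>\<alpha>\<in>supp f. Const (Poly_Mapping.lookup f \<alpha>) * (\<Prod>i\<in>UNIV. (Var i + Const (a i)) ^ \<alpha> i))"

definition greatest_supp :: "('n, 'a::comm_ring_1) mpoly \<Rightarrow> 'n expo \<Rightarrow> bool" where
  "greatest_supp f \<theta> \<longleftrightarrow> \<theta> \<in> supp f \<and> (\<forall>\<alpha>\<in>supp f. \<alpha> \<le> \<theta>)"

definition monic :: "('n, 'a::comm_ring_1) mpoly \<Rightarrow> bool" where
  "monic f \<longleftrightarrow> (\<exists>\<theta>. greatest_supp f \<theta> \<and> Poly_Mapping.lookup f \<theta> = 1)"

definition is_ideal :: "'b::comm_ring_1 set \<Rightarrow> bool" where
  "is_ideal Q \<longleftrightarrow> 0 \<in> Q \<and> (\<forall>f\<in>Q. \<forall>h\<in>Q. f + h \<in> Q) \<and> (\<forall>p. \<forall>f\<in>Q. p * f \<in> Q)"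

text \<open>Families indexed by a set \<open>\<Lambda>\<close> are total functions of which only the values on \<open>\<Lambda>\<close> matter.\<close>

definition groebner_basis ::
  "'l set \<Rightarrow> ('l \<Rightarrow> ('n, 'a::comm_ring_1) mpoly) \<Rightarrow> ('n, 'a) mpoly set \<Rightarrow> bool" where
  "groebner_basis \<Lambda> g Q \<longleftrightarrow>
     is_ideal Q \<and>
     (\<forall>l\<in>\<Lambda>. monic (g l) \<and> g l \<in> Q) \<and>
     (\<forall>\<tau>\<in>Q - {0}. \<exists>\<alpha>\<in>supp \<tau>. \<exists>r\<in>\<Lambda>. \<exists>\<theta>. greatest_supp (g r) \<theta> \<and> \<theta> \<le> \<alpha>)"


subsection \<open>Condition (D)\<close>

text \<open>With this convention \<open>0\<close> is a zero divisor; this is immaterial in Condition (D), where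
  the differences considered are nonzero.\<close>

definition zero_divisor :: "'a::comm_ring_1 \<Rightarrow> bool" where
  "zero_divisor c \<longleftrightarrow> (\<exists>d. d \<noteq> 0 \<and> c * d = 0)"

definition condition_D :: "'a::comm_ring_1 set \<Rightarrow> bool" where
  "condition_D X \<longleftrightarrow> (\<forall>a\<in>X. \<forall>b\<in>X. a \<noteq> b \<longrightarrow> \<not> zero_divisor (b - a))"


subsection \<open>The data attached to a finite grid and a family of multiplicities\<close>

definition grid :: "('n \<Rightarrow> 'a set) \<Rightarrow> ('n \<Rightarrow> 'a) set" where
  "grid S = Pi\<^sub>E UNIV S"

definition grid_poly ::
  "('n::finite \<Rightarrow> 'a::comm_ring_1 set) \<Rightarrow> ('n \<Rightarrow> 'a \<Rightarrow> 'l \<Rightarrow> nat) \<Rightarrow> 'l \<Rightarrow> ('n, 'a) mpoly" where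
  "grid_poly S \<epsilon> l = (\<Prod>i\<in>UNIV. \<Prod>u\<in>S i. (Var i - Const u) ^ \<epsilon> i u l)"

definition theta :: "('n \<Rightarrow> 'a set) \<Rightarrow> ('n \<Rightarrow> 'a \<Rightarrow> 'l \<Rightarrow> nat) \<Rightarrow> 'l \<Rightarrow> 'n expo" where
  "theta S \<epsilon> l = (\<lambda>i. \<Sum>u\<in>S i. \<epsilon> i u l)"

definition D_set :: "('n \<Rightarrow> 'a set) \<Rightarrow> 'l set \<Rightarrow> ('n \<Rightarrow> 'a \<Rightarrow> 'l \<Rightarrow> nat) \<Rightarrow> 'n expo set" where
  "D_set S \<Lambda> \<epsilon> = {theta S \<epsilon> l |l. l \<in> \<Lambda>}"

definition B_set :: "'l set \<Rightarrow> ('n \<Rightarrow> 'a \<Rightarrow> 'l \<Rightarrow> nat) \<Rightarrow> ('n \<Rightarrow> 'a) \<Rightarrow> 'n expo set" where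
  "B_set \<Lambda> \<epsilon> a = {(\<lambda>i. \<epsilon> i (a i) l) |l. l \<in> \<Lambda>}"

definition Q_set ::
  "('n::finite \<Rightarrow> 'a::comm_ring_1 set) \<Rightarrow> 'l set \<Rightarrow> ('n \<Rightarrow> 'a \<Rightarrow> 'l \<Rightarrow> nat) \<Rightarrow> ('n, 'a) mpoly set" where
  "Q_set S \<Lambda> \<epsilon> = {f. \<forall>a\<in>grid S. supp (translate a f) \<subseteq> up_closure (B_set \<Lambda> \<epsilon> a)}"

text \<open>If every \<open>S i\<close> is finite and the complement of \<open>up_closure (D_set S \<Lambda> \<epsilon>)\<close> is
  finite, then so are all the sets counted below, since every element of
  \<open>D_set S \<Lambda> \<epsilon>\<close> dominates one of \<open>B_set \<Lambda> \<epsilon> a\<close>.\<close>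

definition zeta1 :: "('n \<Rightarrow> 'a set) \<Rightarrow> 'l set \<Rightarrow> ('n \<Rightarrow> 'a \<Rightarrow> 'l \<Rightarrow> nat) \<Rightarrow> nat" where
  "zeta1 S \<Lambda> \<epsilon> = (\<Sum>a\<in>grid S. card (UNIV - up_closure (B_set \<Lambda> \<epsilon> a)))"

definition zeta2 :: "('n \<Rightarrow> 'a set) \<Rightarrow> 'l set \<Rightarrow> ('n \<Rightarrow> 'a \<Rightarrow> 'l \<Rightarrow> nat) \<Rightarrow> nat" where
  "zeta2 S \<Lambda> \<epsilon> = card (UNIV - up_closure (D_set S \<Lambda> \<epsilon>))"

end

(* Reducing by the monic g(l) leaves remainders supported on the exponents outside up_closure D,
   so the g(l) form a Groebner basis of Q exactly when a matrix over R is injective: the one sending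
   such a remainder to the zeta1 Taylor coefficients that have to vanish on Q. It has zeta2 columns.
   Under Condition (D) the point ideals are comaximal up to non-zero-divisors, hence the matrix has a
   right inverse up to a diagonal of non-zero-divisors. This makes it injective when it is square,
   and gives zeta1 <= zeta2; as both numbers are combinatorial, zeta1 <= zeta2 holds in general.
   Conversely injectivity forces zeta2 <= zeta1. If moreover c (b - a) = 0 for some c ~= 0 and
   a ~= b in S k, two rows of the matrix agree after multiplication by c, so a square matrix would
   have a kernel vector among the multiples of c. *)
theory Submission
  imports Defs
begin

section \<open>Homogeneous linear systems over a commutative ring\<close>

text \<open>An induction on the rows. A pivot \<open>p = A i j\<close> of the last row either lifts a solution
  of the eliminated system or kills a nonzero multiple of \<open>c\<close>; in the latter case that multiple
  replaces \<open>c\<close> and the last row has fewer entries that are not annihilated by \<open>c\<close>.\<close>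

lemma linear_system_nontrivial_solution:
  fixes A :: "'i \<Rightarrow> 'j \<Rightarrow> 'a::comm_ring_1"
  assumes "finite I" "finite J" "card I < card J" "c \<noteq> 0"
  shows "\<exists>x. (\<forall>j\<in>J. c dvd x j) \<and> (\<exists>j\<in>J. x j \<noteq> 0) \<and> (\<forall>i\<in>I. (\<Sum>j\<in>J. A i j * x j) = 0)"
  using assms
proof (induction I arbitrary: J A c rule: finite_induct)
  case empty
  then have "J \<noteq> {}" by auto
  with empty show ?case by (intro exI[of _ "\<lambda>_. c"]) auto
next
  case (insert i I)
  note IH_rows = insert.IH
  have fJ: "finite J" and cJ: "Suc (card I) < card J"
    using insert by auto
  show ?case
    using \<open>c \<noteq> 0\<close>
  proof (induction "card {j\<in>J. c * A i j \<noteq> 0}" arbitrary: c rule: less_induct)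
    case less
    show ?case
    proof (cases "\<forall>j\<in>J. c * A i j = 0")
      \<comment> \<open>Here \<open>c\<close> annihilates row \<open>i\<close>, so any solution of
        the other rows in multiples of \<open>c\<close> also satisfies row \<open>i\<close>.\<close>
      case True
      obtain x where x: "\<forall>j\<in>J. c dvd x j" "\<exists>j\<in>J. x j \<noteq> 0"
          "\<forall>i\<in>I. (\<Sum>j\<in>J. A i j * x j) = 0"
        using IH_rows[OF fJ _ less.prems, of A] cJ by auto
      have "A i j * x j = 0" if "j \<in> J" for j
        using True x(1) that by (auto simp: dvd_def algebra_simps)
      then have "(\<Sum>j\<in>J. A i j * x j) = 0" by simp
      with x show ?thesis by auto
    next
      case False
      then obtain j where j: "j \<in> J" "c * A i j \<noteq> 0" by auto
      define p where "p = A i j"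
      have cJ': "card I < card (J - {j})" using cJ j fJ by simp
      \<comment> \<open>Column \<open>j\<close> is eliminated by cross-multiplication with the
        pivot, as \<open>p\<close> need not be invertible.\<close>
      obtain x where x: "\<forall>k\<in>J-{j}. c dvd x k" "\<exists>k\<in>J-{j}. x k \<noteq> 0"
          "\<forall>h\<in>I. (\<Sum>k\<in>J-{j}. (A h k * p - A h j * A i k) * x k) = 0"
        using IH_rows[OF _ cJ' less.prems, of "\<lambda>h k. A h k * p - A h j * A i k"] fJ by auto
      show ?thesis
      proof (cases "\<forall>k\<in>J-{j}. p * x k = 0")
        case True
        from x(2) obtain k where k: "k \<in> J - {j}" "x k \<noteq> 0" by auto
        then have ck: "c dvd x k" and pk: "p * x k = 0" using x(1) True by auto
        \<comment> \<open>Passing from \<open>c\<close> to its multiple \<open>x k\<close> loses the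
          pivot column: \<open>c * p\<close> is nonzero while \<open>x k * p\<close>
          vanishes.\<close>
        have "{l\<in>J. x k * A i l \<noteq> 0} \<subset> {l\<in>J. c * A i l \<noteq> 0}"
        proof
          show "{l\<in>J. x k * A i l \<noteq> 0} \<subseteq> {l\<in>J. c * A i l \<noteq> 0}"
            using ck by (auto simp: dvd_def ac_simps)
          show "{l\<in>J. x k * A i l \<noteq> 0} \<noteq> {l\<in>J. c * A i l \<noteq> 0}"
            using j pk by (auto simp: p_def ac_simps)
        qed
        then have "card {l\<in>J. x k * A i l \<noteq> 0} < card {l\<in>J. c * A i l \<noteq> 0}"
          by (intro psubset_card_mono) (use fJ in auto)
        from less.hyps[OF this k(2)] ck show ?thesis by (meson dvd_trans)
      next
        case False
        then obtain k where k: "k \<in> J-{j}" "p * x k \<noteq> 0" by auto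
        \<comment> \<open>Back substitution cleared of denominators: the other unknowns are scaled
          by \<open>p\<close>, and \<open>y j\<close> is chosen to solve row
          \<open>i\<close>.\<close>
        define y where "y = (\<lambda>l. if l = j then - (\<Sum>k\<in>J-{j}. A i k * x k) else p * x l)"
        have y_sum: "(\<Sum>l\<in>J. A h l * y l) = (\<Sum>k\<in>J-{j}. (A h k * p - A h j * A i k) * x k)" for h
        proof -
          have "(\<Sum>l\<in>J. A h l * y l) = A h j * y j + (\<Sum>l\<in>J-{j}. A h l * y l)"
            using fJ j(1) by (simp add: sum.remove)
          also have "(\<Sum>l\<in>J-{j}. A h l * y l) = (\<Sum>l\<in>J-{j}. A h l * (p * x l))"
            by (intro sum.cong) (auto simp: y_def)
          finally show ?thesis
            by (simp add: y_def sum_distrib_left algebra_simps sum_subtractf)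
        qed
        have "c dvd y l" if "l \<in> J" for l
          using x(1) that by (cases "l = j") (auto simp: y_def intro!: dvd_sum dvd_mult)
        moreover have "\<exists>l\<in>J. y l \<noteq> 0" using k by (auto simp: y_def)
        moreover have "(\<Sum>l\<in>J. A h l * y l) = 0" if "h \<in> insert i I" for h
          using that x(3) unfolding y_sum by (elim insertE) (simp_all add: p_def mult.commute)
        ultimately show ?thesis by blast
      qed
    qed
  qed
qed

text \<open>For a kernel vector \<open>x\<close> of minimal support, a scalar that kills one nonzero entry kills
  all of \<open>x\<close>. Solving the transposed system without its row \<open>j\<close>, with \<open>c = x j \<noteq> 0\<close>, the dropped
  equation then follows from \<open>A x = 0\<close>.\<close>

lemma square_kernel_transpose:
  fixes A :: "'i \<Rightarrow> 'j \<Rightarrow> 'a::comm_ring_1"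
  assumes "finite I" "finite J" "card I = card J"
    and "\<exists>j\<in>J. x j \<noteq> 0" "\<forall>i\<in>I. (\<Sum>j\<in>J. A i j * x j) = 0"
  shows "\<exists>y. (\<exists>i\<in>I. y i \<noteq> 0) \<and> (\<forall>j\<in>J. (\<Sum>i\<in>I. A i j * y i) = 0)"
  using assms(4,5)
proof (induction "card {j\<in>J. x j \<noteq> 0}" arbitrary: x rule: less_induct)
  case less
  from less.prems obtain j where j: "j \<in> J" "x j \<noteq> 0" by auto
  show ?case
  proof (cases "\<exists>t. t * x j = 0 \<and> (\<exists>k\<in>J. t * x k \<noteq> 0)")
    case True
    then obtain t where t: "t * x j = 0" "\<exists>k\<in>J. t * x k \<noteq> 0" by auto
    have "{k\<in>J. t * x k \<noteq> 0} \<subset> {k\<in>J. x k \<noteq> 0}" using t j by auto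
    then have "card {k\<in>J. t * x k \<noteq> 0} < card {k\<in>J. x k \<noteq> 0}"
      by (intro psubset_card_mono) (use assms in auto)
    moreover have "\<forall>i\<in>I. (\<Sum>k\<in>J. A i k * (t * x k)) = 0"
    proof
      fix i assume "i \<in> I"
      have "(\<Sum>k\<in>J. A i k * (t * x k)) = t * (\<Sum>k\<in>J. A i k * x k)"
        by (simp add: sum_distrib_left ac_simps)
      with less.prems \<open>i \<in> I\<close> show "(\<Sum>k\<in>J. A i k * (t * x k)) = 0" by simp
    qed
    ultimately show ?thesis using less.hyps[of "\<lambda>k. t * x k"] t by blast
  next
    case False
    \<comment> \<open>In the transposed system \<open>I\<close> indexes the unknowns; dropping one
      equation of a square system leaves fewer equations than unknowns.\<close>
    have "card (J - {j}) < card I"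
      using assms j by (metis card_Diff1_less)
    with linear_system_nontrivial_solution[OF _ assms(1) _ j(2), of "J - {j}" "\<lambda>j i. A i j"] assms(2)
    obtain y where y: "\<forall>i\<in>I. x j dvd y i" "\<exists>i\<in>I. y i \<noteq> 0"
        "\<forall>k\<in>J-{j}. (\<Sum>i\<in>I. A i k * y i) = 0"
      by auto
    from y(1) obtain v where v: "\<And>i. i \<in> I \<Longrightarrow> y i = x j * v i"
      unfolding dvd_def by metis
    define w where "w k = (\<Sum>i\<in>I. A i k * v i)" for k
    have yw: "(\<Sum>i\<in>I. A i k * y i) = w k * x j" for k
      by (simp add: w_def sum_distrib_left v ac_simps cong: sum.cong)
    \<comment> \<open>Equation \<open>k\<close> of the transposed system says that
      \<open>w k\<close> kills \<open>x j\<close>; in the present case it then kills every entry of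
      \<open>x\<close>.\<close>
    have "w k * x k = 0" if "k \<in> J - {j}" for k
      using False yw[of k] y(3) that by auto
    \<comment> \<open>This is the pairing of \<open>v\<close> with \<open>A x = 0\<close>. All its
      terms except the one at \<open>j\<close> vanish, and that one is the dropped equation by
      \<open>yw\<close>.\<close>
    moreover have "(\<Sum>k\<in>J. w k * x k) = 0"
    proof -
      have "(\<Sum>k\<in>J. w k * x k) = (\<Sum>k\<in>J. \<Sum>i\<in>I. v i * (A i k * x k))"
        by (simp add: w_def sum_distrib_left sum_distrib_right ac_simps)
      also have "\<dots> = (\<Sum>i\<in>I. v i * (\<Sum>k\<in>J. A i k * x k))"
        by (subst sum.swap) (simp add: sum_distrib_left)
      finally show ?thesis using less.prems by simp
    qed
    ultimately have "w j * x j = 0"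
      using j(1) assms(2) by (simp add: sum.remove)
    then show ?thesis using y yw by (metis Diff_iff singletonD)
  qed
qed

section \<open>Polynomials and translations\<close>

lemma lookup_Const_mult: "Poly_Mapping.lookup (Const c * p) \<beta> = c * Poly_Mapping.lookup p \<beta>"
proof -
  have "Const c * p = Poly_Mapping.map ((*) c) p"
    by (simp add: Const_def mult_map_scale_conv_mult)
  then show ?thesis by (simp add: Poly_Mapping.map.rep_eq when_def)
qed

lemma Const_add: "Const (c + d) = Const c + Const d"
  by (simp add: Const_def single_add)

lemma Const_mult: "Const (c * d) = Const c * Const d"
  by (simp add: Const_def mult_single)

lemma Const_0 [simp]: "Const 0 = 0" and Const_1 [simp]: "Const 1 = 1"
  by (simp_all add: Const_def)

lemma Const_uminus: "Const (- c) = - Const c"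
  by (simp add: Const_def single_uminus)

lemma Const_diff: "Const (c - d) = Const c - Const d"
  by (simp add: Const_def single_diff)

lemma Const_power: "Const (c ^ k) = Const c ^ k"
  by (induction k) (simp_all add: Const_mult)

lemma Const_prod: "Const (\<Prod>x\<in>X. h x) = (\<Prod>x\<in>X. Const (h x))"
  by (induction X rule: infinite_finite_induct) (simp_all add: Const_mult)

lemma sum_apply: "(\<Sum>x\<in>X. h x) j = (\<Sum>x\<in>X. h x j)"
  for h :: "'x \<Rightarrow> 'j \<Rightarrow> 'b::comm_monoid_add"
  by (induction X rule: infinite_finite_induct) (simp_all add: zero_fun_def)

lemma sum_monomials:
  fixes f :: "'k \<Rightarrow>\<^sub>0 'b::comm_monoid_add"
  assumes "finite J" "Poly_Mapping.keys f \<subseteq> J"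
  shows "(\<Sum>\<alpha>\<in>J. Poly_Mapping.single \<alpha> (Poly_Mapping.lookup f \<alpha>)) = f"
proof (rule poly_mapping_eqI)
  fix k
  show "Poly_Mapping.lookup (\<Sum>\<alpha>\<in>J. Poly_Mapping.single \<alpha> (Poly_Mapping.lookup f \<alpha>)) k
      = Poly_Mapping.lookup f k"
    using assms by (auto simp: lookup_sum lookup_single when_def sum.delta' in_keys_iff)
qed

lemma keys_sum_subset: "Poly_Mapping.keys (\<Sum>x\<in>X. h x) \<subseteq> (\<Union>x\<in>X. Poly_Mapping.keys (h x))"
  for h :: "'x \<Rightarrow> ('k \<Rightarrow>\<^sub>0 'b::comm_monoid_add)"
proof (induction X rule: infinite_finite_induct)
  case (insert x X)
  then show ?case using keys_add[of "h x" "\<Sum>x\<in>X. h x"] by auto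
qed auto

lemma prod_single_one:
  "(\<Prod>x\<in>X. Poly_Mapping.single (h x) (1::'a::comm_ring_1))
     = Poly_Mapping.single (\<Sum>x\<in>X. h x) 1"
  for h :: "'x \<Rightarrow> 'k::comm_monoid_add"
  by (induction X rule: infinite_finite_induct) (simp_all add: mult_single)

lemma Var_power: "Var i ^ k = Poly_Mapping.single (\<lambda>j. if j = i then k else 0) 1"
proof (induction k)
  case 0
  show ?case by (simp add: zero_fun_def[symmetric])
next
  case (Suc k)
  then show ?case
    by (simp add: Var_def mult_single plus_fun_def) (rule arg_cong[of _ _ "\<lambda>\<alpha>. Poly_Mapping.single \<alpha> 1"], auto)
qed

lemma prod_Var_power: "(\<Prod>i\<in>UNIV. Var i ^ \<alpha> i) = Poly_Mapping.single \<alpha> (1::'a::comm_ring_1)"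
  for \<alpha> :: "'n::finite expo"
proof -
  have "(\<Sum>i\<in>UNIV. (\<lambda>j. if j = i then \<alpha> i else 0)) = \<alpha>"
    by (rule ext) (simp add: sum_apply)
  then show ?thesis by (simp add: Var_power prod_single_one)
qed

abbreviation shifted_monomial :: "('n::finite \<Rightarrow> 'a::comm_ring_1) \<Rightarrow> 'n expo \<Rightarrow> ('n, 'a) mpoly" where
  "shifted_monomial a \<alpha> \<equiv> \<Prod>i\<in>UNIV. (Var i + Const (a i)) ^ \<alpha> i"

lemma shifted_monomial_add:
  "shifted_monomial a (\<alpha> + \<beta>) = shifted_monomial a \<alpha> * shifted_monomial a \<beta>"
  by (simp add: power_add prod.distrib)

lemma translate_superset:
  assumes "finite J" "supp f \<subseteq> J"
  shows "translate a f = (\<Sum>\<alpha>\<in>J. Const (Poly_Mapping.lookup f \<alpha>) * shifted_monomial a \<alpha>)"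
  unfolding translate_def using assms
  by (intro sum.mono_neutral_left) (auto simp: in_keys_iff)

lemma translate_add: "translate a (f + g) = translate a f + translate a g"
proof -
  let ?J = "supp f \<union> supp g"
  have "translate a h = (\<Sum>\<alpha>\<in>?J. Const (Poly_Mapping.lookup h \<alpha>) * shifted_monomial a \<alpha>)"
    if "h \<in> {f, g, f + g}" for h
    using that keys_add[of f g] by (intro translate_superset) auto
  then show ?thesis
    by (simp add: lookup_add Const_add distrib_right sum.distrib)
qed

lemma translate_0 [simp]: "translate a 0 = 0"
  by (simp add: translate_def)

lemma translate_sum: "translate a (\<Sum>x\<in>X. h x) = (\<Sum>x\<in>X. translate a (h x))"
  by (induction X rule: infinite_finite_induct) (simp_all add: translate_add)

lemma translate_single: "translate a (Poly_Mapping.single \<alpha> c) = Const c * shifted_monomial a \<alpha>"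
  by (subst translate_superset[of "{\<alpha>}"]) auto

text \<open>Both factors are expanded into monomials, where the claim is
  \<open>shifted_monomial_add\<close>.\<close>

lemma translate_mult: "translate a (f * g) = translate a f * translate a g"
proof -
  let ?m = "\<lambda>h \<alpha>. Poly_Mapping.single \<alpha> (Poly_Mapping.lookup h \<alpha>)"
  have "f * g = (\<Sum>\<alpha>\<in>supp f. ?m f \<alpha>) * (\<Sum>\<beta>\<in>supp g. ?m g \<beta>)"
    by (simp add: sum_monomials)
  also have "\<dots> = (\<Sum>\<alpha>\<in>supp f. \<Sum>\<beta>\<in>supp g.
      Poly_Mapping.single (\<alpha> + \<beta>) (Poly_Mapping.lookup f \<alpha> * Poly_Mapping.lookup g \<beta>))"
    by (simp add: sum_product mult_single)
  finally have "translate a (f * g) = (\<Sum>\<alpha>\<in>supp f. \<Sum>\<beta>\<in>supp g.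
      Const (Poly_Mapping.lookup f \<alpha> * Poly_Mapping.lookup g \<beta>) * shifted_monomial a (\<alpha> + \<beta>))"
    by (simp add: translate_sum translate_single)
  also have "\<dots> = translate a f * translate a g"
    unfolding translate_def sum_product
    by (simp only: Const_mult shifted_monomial_add ac_simps)
  finally show ?thesis .
qed

lemma translate_Const: "translate a (Const c) = Const c"
  by (simp add: Const_def translate_single)

lemma translate_1 [simp]: "translate a 1 = 1"
  using translate_Const[of a 1] by simp

lemma translate_Var: "translate a (Var i) = Var i + Const (a i)"
proof -
  have "shifted_monomial a (\<lambda>j. if j = i then 1 else 0)
      = (\<Prod>j\<in>UNIV. if j = i then Var j + Const (a j) else 1)"
    by (intro prod.cong) auto
  then show ?thesis by (simp add: Var_def[of i] translate_single prod.delta)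
qed

lemma translate_linear: "translate a (Var i - Const u) = Var i + Const (a i - u)"
  using translate_add[of a "Var i" "Const (- u)"] translate_Const[of a "- u"]
  by (simp add: translate_Var Const_uminus Const_diff)

lemma translate_prod: "translate a (\<Prod>x\<in>X. h x) = (\<Prod>x\<in>X. translate a (h x))"
  by (induction X rule: infinite_finite_induct) (simp_all add: translate_mult)

lemma translate_power: "translate a (f ^ k) = translate a f ^ k"
  by (induction k) (simp_all add: translate_mult)

text \<open>Taylor coefficients at \<open>a\<close> are linear in the coefficients of
  \<open>f\<close>; the entries of the matrix are read off here.\<close>

lemma lookup_translate:
  assumes "finite J" "supp f \<subseteq> J"
  shows "Poly_Mapping.lookup (translate a f) \<beta>
    = (\<Sum>\<alpha>\<in>J. Poly_Mapping.lookup (shifted_monomial a \<alpha>) \<beta> * Poly_Mapping.lookup f \<alpha>)"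
  by (simp add: translate_superset[OF assms] lookup_sum lookup_Const_mult ac_simps)

section \<open>Ideals of vanishing conditions\<close>

lemma ideal_mult: "is_ideal Q \<Longrightarrow> f \<in> Q \<Longrightarrow> p * f \<in> Q"
  by (simp add: is_ideal_def)

lemma ideal_dvd: "is_ideal Q \<Longrightarrow> f \<in> Q \<Longrightarrow> f dvd h \<Longrightarrow> h \<in> Q"
  by (auto simp: dvd_def mult.commute intro: ideal_mult)

lemma ideal_add: "is_ideal Q \<Longrightarrow> f \<in> Q \<Longrightarrow> h \<in> Q \<Longrightarrow> f + h \<in> Q"
  by (simp add: is_ideal_def)

lemma ideal_diff: "is_ideal Q \<Longrightarrow> f \<in> Q \<Longrightarrow> h \<in> Q \<Longrightarrow> f - h \<in> Q"
  using ideal_add[of Q f "- h"] ideal_mult[of Q h "- 1"] by simp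

lemma ideal_sum: "is_ideal Q \<Longrightarrow> (\<And>x. x \<in> X \<Longrightarrow> h x \<in> Q) \<Longrightarrow> (\<Sum>x\<in>X. h x) \<in> Q"
  by (induction X rule: infinite_finite_induct) (auto simp: is_ideal_def)

lemma ideal_INT: "(\<And>x. x \<in> X \<Longrightarrow> is_ideal (I x)) \<Longrightarrow> is_ideal (\<Inter>x\<in>X. I x)"
  by (simp add: is_ideal_def)

lemma up_closure_mono: "\<alpha> \<in> up_closure B \<Longrightarrow> \<alpha> \<le> \<beta> \<Longrightarrow> \<beta> \<in> up_closure B"
  unfolding up_closure_def by (auto intro: order_trans)

text \<open>The local condition at a single point; \<open>Q_set\<close> is the intersection of these
  over the grid.\<close>

definition point_ideal :: "'n expo set \<Rightarrow> ('n::finite \<Rightarrow> 'a::comm_ring_1) \<Rightarrow> ('n, 'a) mpoly set" where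
  "point_ideal B a = {f. supp (translate a f) \<subseteq> up_closure B}"

text \<open>Translation is a ring homomorphism, and this is the preimage of a monomial ideal: adding
  any exponent stays inside \<open>up_closure B\<close>.\<close>

lemma point_ideal_ideal: "is_ideal (point_ideal B a)"
  unfolding is_ideal_def
proof (intro conjI ballI allI)
  show "0 \<in> point_ideal B a" by (simp add: point_ideal_def)
  fix f assume f: "f \<in> point_ideal B a"
  show "f + h \<in> point_ideal B a" if "h \<in> point_ideal B a" for h
    using f that keys_add[of "translate a f" "translate a h"]
    by (auto simp: point_ideal_def translate_add)
  show "p * f \<in> point_ideal B a" for p
  proof -
    have "\<gamma> \<in> up_closure B" if \<gamma>: "\<gamma> \<in> supp (translate a p * translate a f)" for \<gamma>
    proof -
      from \<gamma> keys_mult obtain \<alpha> \<beta> where "\<gamma> = \<alpha> + \<beta>" "\<beta> \<in> supp (translate a f)" by blast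
      moreover have "\<beta> \<le> \<alpha> + \<beta>" by (simp add: le_fun_def)
      ultimately show ?thesis
        using f up_closure_mono unfolding point_ideal_def by blast
    qed
    then show ?thesis by (auto simp: point_ideal_def translate_mult)
  qed
qed

text \<open>Translation by \<open>a\<close> turns this product into the single monomial with
  exponent \<alpha>.\<close>

lemma point_ideal_single:
  assumes "\<alpha> \<in> up_closure B"
  shows "(\<Prod>i\<in>UNIV. (Var i - Const (a i)) ^ \<alpha> i) \<in> point_ideal B a"
  using assms
  by (simp add: point_ideal_def translate_prod translate_power translate_linear prod_Var_power)

lemma Q_set_eq: "Q_set S \<Lambda> \<epsilon> = (\<Inter>a\<in>grid S. point_ideal (B_set \<Lambda> \<epsilon> a) a)"
  by (auto simp: Q_set_def point_ideal_def)

lemma Q_set_ideal: "is_ideal (Q_set S \<Lambda> \<epsilon>)"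
  unfolding Q_set_eq by (intro ideal_INT point_ideal_ideal)

text \<open>The factors with \<open>u = a i\<close> alone already form an element of the ideal, and
  they divide \<open>grid_poly S \<epsilon> l\<close>.\<close>

lemma grid_poly_in_point_ideal:
  assumes fin: "\<And>i. finite (S i)" and "a \<in> grid S" "l \<in> \<Lambda>"
  shows "grid_poly S \<epsilon> l \<in> point_ideal (B_set \<Lambda> \<epsilon> a) a"
proof (rule ideal_dvd[OF point_ideal_ideal])
  have "(\<lambda>i. \<epsilon> i (a i) l) \<in> up_closure (B_set \<Lambda> \<epsilon> a)"
    unfolding up_closure_def B_set_def using \<open>l \<in> \<Lambda>\<close> by blast
  then show "(\<Prod>i\<in>UNIV. (Var i - Const (a i)) ^ \<epsilon> i (a i) l) \<in> point_ideal (B_set \<Lambda> \<epsilon> a) a"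
    by (rule point_ideal_single)
  have "(Var i - Const (a i)) ^ \<epsilon> i (a i) l dvd (\<Prod>u\<in>S i. (Var i - Const u) ^ \<epsilon> i u l)" for i
    using \<open>a \<in> grid S\<close>
    by (intro dvd_prodI[OF fin, where f = "\<lambda>u. (Var i - Const u) ^ \<epsilon> i u l"]) (auto simp: grid_def)
  then show "(\<Prod>i\<in>UNIV. (Var i - Const (a i)) ^ \<epsilon> i (a i) l) dvd grid_poly S \<epsilon> l"
    unfolding grid_poly_def by (rule prod_dvd_prod)
qed

section \<open>Leading monomials and division\<close>

text \<open>Monicity with greatest exponent \<theta>, with the leading monomial split off as a
  summand so that products can be multiplied out.\<close>

definition has_lead :: "('n, 'a::comm_ring_1) mpoly \<Rightarrow> 'n expo \<Rightarrow> bool" where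
  "has_lead f \<theta> \<longleftrightarrow> (\<exists>h. f = Poly_Mapping.single \<theta> 1 + h \<and> (\<forall>\<alpha>\<in>supp h. \<alpha> < \<theta>))"

lemma has_lead_lookup: "has_lead f \<theta> \<Longrightarrow> Poly_Mapping.lookup f \<theta> = 1"
  by (auto simp: has_lead_def lookup_add in_keys_iff)

lemma has_lead_greatest_supp: "has_lead f \<theta> \<Longrightarrow> greatest_supp f \<theta>"
proof -
  assume f: "has_lead f \<theta>"
  then obtain h where "f = Poly_Mapping.single \<theta> 1 + h" "\<forall>\<alpha>\<in>supp h. \<alpha> < \<theta>"
    by (auto simp: has_lead_def)
  then have "\<forall>\<alpha>\<in>supp f. \<alpha> \<le> \<theta>"
    using keys_add[of "Poly_Mapping.single \<theta> 1" h] by (auto simp: less_imp_le)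
  then show ?thesis using has_lead_lookup[OF f] by (simp add: greatest_supp_def in_keys_iff)
qed

lemma has_lead_1: "has_lead 1 0"
  by (auto simp: has_lead_def intro!: exI[of _ 0])

text \<open>The product of the leading monomials has coefficient 1, so zero divisors cannot cancel
  it; every other term has a strictly smaller exponent in one factor.\<close>

lemma has_lead_mult:
  assumes "has_lead f \<theta>" "has_lead g \<eta>"
  shows "has_lead (f * g) (\<theta> + \<eta>)"
proof -
  from assms obtain p q where p: "f = Poly_Mapping.single \<theta> 1 + p" "\<forall>\<alpha>\<in>supp p. \<alpha> < \<theta>"
    and q: "g = Poly_Mapping.single \<eta> 1 + q" "\<forall>\<alpha>\<in>supp q. \<alpha> < \<eta>"
    unfolding has_lead_def by blast
  have g: "\<forall>\<alpha>\<in>supp g. \<alpha> \<le> \<eta>"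
    using has_lead_greatest_supp[OF assms(2)] by (simp add: greatest_supp_def)
  have "f * g = Poly_Mapping.single (\<theta> + \<eta>) 1 + (Poly_Mapping.single \<theta> 1 * q + p * g)"
    by (simp add: p q mult_single algebra_simps)
  moreover have "\<alpha> < \<theta> + \<eta>" if "\<alpha> \<in> supp (Poly_Mapping.single \<theta> 1 * q + p * g)" for \<alpha>
  proof -
    from subsetD[OF keys_add that] show ?thesis
    proof
      assume "\<alpha> \<in> supp (Poly_Mapping.single \<theta> 1 * q)"
      then obtain \<beta> where "\<beta> \<in> supp q" "\<alpha> = \<theta> + \<beta>"
        using keys_mult[of "Poly_Mapping.single \<theta> 1" q] by auto
      then show ?thesis using q(2) by (auto intro: add_strict_left_mono)
    next
      assume "\<alpha> \<in> supp (p * g)"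
      then obtain \<beta> \<gamma> where "\<beta> \<in> supp p" "\<gamma> \<in> supp g" "\<alpha> = \<beta> + \<gamma>"
        using keys_mult[of p g] by auto
      then show ?thesis using p(2) g by (auto intro: add_less_le_mono)
    qed
  qed
  ultimately show ?thesis unfolding has_lead_def
    by (intro exI[of _ "Poly_Mapping.single \<theta> 1 * q + p * g"] conjI ballI)
qed

lemma has_lead_prod: "(\<And>x. x \<in> X \<Longrightarrow> has_lead (h x) (\<theta> x)) \<Longrightarrow> has_lead (\<Prod>x\<in>X. h x) (\<Sum>x\<in>X. \<theta> x)"
  by (induction X rule: infinite_finite_induct) (auto simp: has_lead_1 has_lead_mult)

lemma has_lead_linear_power:
  "has_lead ((Var i - Const u) ^ k) (\<lambda>j. if j = i then k else 0)"
proof (induction k)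
  case 0
  show ?case using has_lead_1 by (simp add: zero_fun_def)
next
  case (Suc k)
  have "0 \<le> (\<lambda>j. if j = i then 1 else (0::nat))" "0 \<noteq> (\<lambda>j. if j = i then 1 else (0::nat))"
    by (auto simp: le_fun_def fun_eq_iff)
  then have "0 < (\<lambda>j. if j = i then 1 else (0::nat))"
    by (rule order.not_eq_order_implies_strict[rotated])
  then have "has_lead (Var i - Const u) (\<lambda>j. if j = i then 1 else 0)"
    unfolding has_lead_def
    by (intro exI[of _ "- Const u"]) (simp add: Var_def Const_def flip: single_uminus)
  from has_lead_mult[OF this Suc.IH] show ?case
    by (simp add: plus_fun_def if_distrib[of "\<lambda>x. x + _"] cong: if_cong)
qed

lemma has_lead_grid_poly: "has_lead (grid_poly S \<epsilon> l) (theta S \<epsilon> l)"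
proof -
  have "theta S \<epsilon> l = (\<Sum>i\<in>UNIV. \<Sum>u\<in>S i. (\<lambda>j. if j = i then \<epsilon> i u l else 0))"
  proof
    fix j
    have "(\<Sum>i\<in>UNIV. \<Sum>u\<in>S i. if j = i then \<epsilon> i u l else 0)
        = (\<Sum>i\<in>UNIV. if j = i then \<Sum>u\<in>S i. \<epsilon> i u l else 0)"
      by (intro sum.cong) auto
    then show "theta S \<epsilon> l j = (\<Sum>i\<in>UNIV. \<Sum>u\<in>S i. (\<lambda>j. if j = i then \<epsilon> i u l else 0)) j"
      by (simp add: theta_def sum_apply)
  qed
  then show ?thesis
    unfolding grid_poly_def by (simp only:) (intro has_lead_prod has_lead_linear_power)
qed

text \<open>Monomials are reduced by induction on the degree; since \<open>\<alpha> - \<theta> + \<gamma> \<le> \<alpha>\<close> for every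
  exponent \<open>\<gamma>\<close> of a divisor with leading exponent \<open>\<theta>\<close>, all supports stay below \<open>supp f\<close>.\<close>

lemma division:
  fixes g :: "'l \<Rightarrow> ('n::finite, 'a::comm_ring_1) mpoly"
  assumes "finite \<Lambda>" and lead: "\<And>l. l \<in> \<Lambda> \<Longrightarrow> has_lead (g l) (\<theta> l)"
  shows "\<exists>p r. f = (\<Sum>l\<in>\<Lambda>. p l * g l) + r \<and>
    supp r \<subseteq> down_closure (supp f) - up_closure (\<theta> ` \<Lambda>) \<and>
    (\<forall>l\<in>\<Lambda>. supp (p l) + supp (g l) \<subseteq> down_closure (supp f))"
proof -
  define A where "A = down_closure (supp f)"
  have A_down: "\<beta> \<in> A" if "\<alpha> \<in> A" "\<beta> \<le> \<alpha>" for \<alpha> \<beta>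
    using that by (auto simp: A_def down_closure_def intro: order_trans)
  \<comment> \<open>The bound \<open>A\<close> is fixed once for \<open>f\<close>, so that
    \<open>P\<close> is closed under addition and it suffices to treat monomials with exponent in
    \<open>A\<close>.\<close>
  define P where "P h \<longleftrightarrow> (\<exists>p r. h = (\<Sum>l\<in>\<Lambda>. p l * g l) + r \<and>
    supp r \<subseteq> A - up_closure (\<theta> ` \<Lambda>) \<and> (\<forall>l\<in>\<Lambda>. supp (p l) + supp (g l) \<subseteq> A))" for h
  have P_add: "P (h + k)" if "P h" "P k" for h k
  proof -
    from that obtain p r q s where
      "h = (\<Sum>l\<in>\<Lambda>. p l * g l) + r" "supp r \<subseteq> A - up_closure (\<theta> ` \<Lambda>)"
      "\<forall>l\<in>\<Lambda>. supp (p l) + supp (g l) \<subseteq> A"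
      "k = (\<Sum>l\<in>\<Lambda>. q l * g l) + s" "supp s \<subseteq> A - up_closure (\<theta> ` \<Lambda>)"
      "\<forall>l\<in>\<Lambda>. supp (q l) + supp (g l) \<subseteq> A"
      unfolding P_def by blast
    note pq = this
    have "supp (p l + q l) + supp (g l) \<subseteq> A" if "l \<in> \<Lambda>" for l
    proof -
      have "supp (p l + q l) + supp (g l) \<subseteq> (supp (p l) \<union> supp (q l)) + supp (g l)"
        by (intro set_plus_mono2 keys_add order_refl)
      also have "\<dots> = (supp (p l) + supp (g l)) \<union> (supp (q l) + supp (g l))"
        by (auto simp: set_plus_def)
      also have "\<dots> \<subseteq> A" using pq(3,6) that by (intro Un_least) simp_all
      finally show ?thesis .
    qed
    moreover have "supp (r + s) \<subseteq> A - up_closure (\<theta> ` \<Lambda>)"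
      using keys_add[of r s] pq(2,5) by (meson Un_least order_trans)
    moreover have "h + k = (\<Sum>l\<in>\<Lambda>. (p l + q l) * g l) + (r + s)"
      by (simp add: pq(1,4) distrib_right sum.distrib)
    ultimately show ?thesis
      unfolding P_def by (intro exI[of _ "\<lambda>l. p l + q l"] exI[of _ "r + s"] conjI ballI)
  qed
  have P_0: "P 0"
    unfolding P_def by (intro exI[of _ "\<lambda>_. 0"] exI[of _ 0]) (auto simp: set_plus_def)
  have P_sum: "P (\<Sum>x\<in>X. h x)" if "\<And>x. x \<in> X \<Longrightarrow> P (h x)" for X and h :: "'n expo \<Rightarrow> ('n, 'a) mpoly"
    using that by (induction X rule: infinite_finite_induct) (auto simp: P_0 P_add)
  have P_single: "P (Poly_Mapping.single \<alpha> c)" if "\<alpha> \<in> A" for \<alpha> c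
    using that
  proof (induction "\<Sum>i\<in>UNIV. \<alpha> i" arbitrary: \<alpha> c rule: less_induct)
    case less
    show ?case
    proof (cases "\<alpha> \<in> up_closure (\<theta> ` \<Lambda>)")
      case False
      then show ?thesis
        unfolding P_def using less.prems
        by (intro exI[of _ "\<lambda>_. 0"] exI[of _ "Poly_Mapping.single \<alpha> c"]) (auto simp: set_plus_def)
    next
      case True
      then obtain l where l: "l \<in> \<Lambda>" "\<theta> l \<le> \<alpha>" by (auto simp: up_closure_def)
      \<comment> \<open>The exponent of the quotient monomial; the truncated subtraction is exact
        because \<theta> l \<le> \<alpha>.\<close>
      define \<delta> where "\<delta> = (\<lambda>i. \<alpha> i - \<theta> l i)"
      have \<delta>: "\<delta> + \<theta> l = \<alpha>" using l by (auto simp: \<delta>_def le_fun_def)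
      from lead[OF l(1)] obtain h where h: "g l = Poly_Mapping.single (\<theta> l) 1 + h"
          "\<forall>\<beta>\<in>supp h. \<beta> < \<theta> l"
        unfolding has_lead_def by blast
      define k where "k = - (Poly_Mapping.single \<delta> c * h)"
      have eq: "Poly_Mapping.single \<alpha> c = Poly_Mapping.single \<delta> c * g l + k"
        by (simp add: k_def h distrib_left mult_single \<delta>)
      have "\<delta> + \<gamma> \<in> A" if "\<gamma> \<in> supp (g l)" for \<gamma>
      proof -
        have "\<gamma> \<le> \<theta> l" using has_lead_greatest_supp[OF lead[OF l(1)]] that
          by (simp add: greatest_supp_def)
        then have "\<delta> + \<gamma> \<le> \<alpha>" using \<delta> by (metis add_left_mono)
        then show ?thesis using less.prems A_down by blast
      qed
      then have "P (Poly_Mapping.single \<delta> c * g l)"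
        unfolding P_def using l \<open>finite \<Lambda>\<close>
        by (intro exI[of _ "\<lambda>m. if m = l then Poly_Mapping.single \<delta> c else 0"] exI[of _ 0])
          (auto simp: set_plus_def if_distrib[of "\<lambda>x. x * _"] sum.delta cong: if_cong split: if_splits)
      moreover have "P (\<Sum>\<beta>\<in>supp k. Poly_Mapping.single \<beta> (Poly_Mapping.lookup k \<beta>))"
      proof (rule P_sum)
        fix \<beta> assume "\<beta> \<in> supp k"
        then have "\<beta> \<in> supp (Poly_Mapping.single \<delta> c * h)" by (simp add: k_def in_keys_iff)
        then obtain \<gamma> where "\<gamma> \<in> supp h" "\<beta> = \<delta> + \<gamma>"
          using keys_mult[of "Poly_Mapping.single \<delta> c" h] by (auto split: if_splits)
        then have \<beta>: "\<beta> < \<alpha>" using h(2) add_strict_left_mono[of \<gamma> "\<theta> l" \<delta>] \<delta> by auto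
        then have "\<beta> \<le> \<alpha>" "\<not> \<alpha> \<le> \<beta>" unfolding less_le_not_le by simp_all
        then have "(\<Sum>i\<in>UNIV. \<beta> i) < (\<Sum>i\<in>UNIV. \<alpha> i)"
          by (intro sum_strict_mono_ex1) (auto simp: le_fun_def not_le)
        moreover have "\<beta> \<in> A" using \<beta> less.prems A_down by (auto dest: less_imp_le)
        ultimately show "P (Poly_Mapping.single \<beta> (Poly_Mapping.lookup k \<beta>))"
          by (rule less.hyps)
      qed
      ultimately show ?thesis using P_add eq by (simp add: sum_monomials)
    qed
  qed
  have "P (\<Sum>\<alpha>\<in>supp f. Poly_Mapping.single \<alpha> (Poly_Mapping.lookup f \<alpha>))"
    by (intro P_sum P_single) (auto simp: A_def down_closure_def)
  then show ?thesis
    by (simp add: sum_monomials P_def A_def)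
qed

section \<open>Comaximal powers and non-zero-divisors\<close>

text \<open>The witness is \<open>((u - w) ^ N - (- w) ^ N) ^ N\<close>: its base is divisible by
  \<open>u\<close> and congruent to \<open>(u - w) ^ N\<close> modulo \<open>w ^ N\<close>. It is
  meant for linear factors at two points, whose difference \<open>u - w\<close> is a
  constant.\<close>

lemma power_comaximal:
  fixes u w :: "'b::comm_ring_1"
  shows "\<exists>P. u ^ N dvd P \<and> w ^ N dvd P - (u - w) ^ (N * N)"
proof -
  have dvd_diff: "x - y dvd x ^ k - y ^ k" for x y :: 'b and k
    by (simp add: power_diff_sumr2)
  have "u dvd (u - w) ^ N - (- w) ^ N"
    using dvd_diff[of "u - w" "- w" N] by simp
  then have "u ^ N dvd ((u - w) ^ N - (- w) ^ N) ^ N"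
    by (rule dvd_power_same)
  moreover have "w ^ N dvd (- w) ^ N" by (simp add: dvd_power_same)
  then have "w ^ N dvd ((u - w) ^ N - (- w) ^ N) ^ N - ((u - w) ^ N) ^ N"
    using dvd_diff[of "(u - w) ^ N - (- w) ^ N" "(u - w) ^ N" N] by (auto intro: dvd_trans)
  ultimately show ?thesis by (auto simp: power_mult)
qed

lemma ideal_prod_diff:
  assumes Q: "is_ideal Q" and "\<And>x. x \<in> X \<Longrightarrow> p x - q x \<in> Q"
  shows "(\<Prod>x\<in>X. p x) - (\<Prod>x\<in>X. q x) \<in> Q"
  using assms(2)
proof (induction X rule: infinite_finite_induct)
  case (insert x X)
  have "(\<Prod>x\<in>insert x X. p x) - (\<Prod>x\<in>insert x X. q x)
      = (\<Prod>x\<in>X. p x) * (p x - q x) + q x * ((\<Prod>x\<in>X. p x) - (\<Prod>x\<in>X. q x))"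
    using insert.hyps by (simp add: algebra_simps)
  with insert show ?case by (auto intro!: ideal_add[OF Q] ideal_mult[OF Q])
qed (use Q in \<open>auto simp: is_ideal_def\<close>)

lemma not_zero_divisor_1: "\<not> zero_divisor 1"
  by (simp add: zero_divisor_def)

lemma not_zero_divisor_mult: "\<not> zero_divisor c \<Longrightarrow> \<not> zero_divisor d \<Longrightarrow> \<not> zero_divisor (c * d)"
  unfolding zero_divisor_def by (metis mult.assoc)

lemma not_zero_divisor_power: "\<not> zero_divisor c \<Longrightarrow> \<not> zero_divisor (c ^ k)"
  by (induction k) (auto simp: not_zero_divisor_1 not_zero_divisor_mult)

lemma not_zero_divisor_prod:
  "(\<And>x. x \<in> X \<Longrightarrow> \<not> zero_divisor (h x)) \<Longrightarrow> \<not> zero_divisor (\<Prod>x\<in>X. h x)"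
  by (induction X rule: infinite_finite_induct) (auto simp: not_zero_divisor_1 not_zero_divisor_mult)

section \<open>The vanishing ideal of a grid with multiplicities\<close>

locale grid_data =
  fixes S :: "'n::finite \<Rightarrow> 'a::comm_ring_1 set"
    and \<Lambda> :: "'l set"
    and \<epsilon> :: "'n \<Rightarrow> 'a \<Rightarrow> 'l \<Rightarrow> nat"
  assumes finite_S: "\<And>i. finite (S i)"
    and finite_\<Lambda>: "finite \<Lambda>"
    and finite_D: "finite (UNIV - up_closure (D_set S \<Lambda> \<epsilon>))"
begin

abbreviation "g \<equiv> grid_poly S \<epsilon>"
abbreviation "Q \<equiv> Q_set S \<Lambda> \<epsilon>"
abbreviation "B \<equiv> B_set \<Lambda> \<epsilon>"

text \<open>The matrix with rows \<open>conditions\<close>, columns \<open>standard\<close> and entries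
  \<open>lookup (shifted_monomial a \<alpha>) \<beta>\<close> sends the coefficients of a polynomial supported on
  \<open>standard\<close> to the Taylor coefficients whose vanishing defines \<open>Q\<close>.\<close>

definition standard :: "'n expo set" where
  "standard = UNIV - up_closure (D_set S \<Lambda> \<epsilon>)"

definition conditions :: "(('n \<Rightarrow> 'a) \<times> 'n expo) set" where
  "conditions = (SIGMA a:grid S. UNIV - up_closure (B a))"

lemma finite_grid: "finite (grid S)"
  unfolding grid_def by (intro finite_PiE finite_S) auto

text \<open>Each coordinate of \<open>theta S \<epsilon> l\<close> is a sum having
  \<open>\<epsilon> i (a i) l\<close> among its terms. Finiteness thus passes from D to every local
  complement.\<close>

lemma up_closure_D_subset:
  assumes "a \<in> grid S"
  shows "up_closure (D_set S \<Lambda> \<epsilon>) \<subseteq> up_closure (B a)"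
proof
  fix \<alpha> assume "\<alpha> \<in> up_closure (D_set S \<Lambda> \<epsilon>)"
  then obtain l where l: "l \<in> \<Lambda>" "theta S \<epsilon> l \<le> \<alpha>"
    by (auto simp: up_closure_def D_set_def)
  have "a i \<in> S i" for i using assms by (auto simp: grid_def)
  then have "(\<lambda>i. \<epsilon> i (a i) l) \<le> theta S \<epsilon> l"
    by (auto simp: le_fun_def theta_def intro!: member_le_sum finite_S)
  then show "\<alpha> \<in> up_closure (B a)"
    using l by (auto simp: up_closure_def B_set_def intro: order_trans)
qed

lemma finite_standard: "finite standard"
  using finite_D by (simp add: standard_def)

lemma finite_B: "a \<in> grid S \<Longrightarrow> finite (UNIV - up_closure (B a))"
  using up_closure_D_subset finite_D by (meson Diff_mono finite_subset order_refl)

lemma finite_conditions: "finite conditions"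
  unfolding conditions_def using finite_grid finite_B by auto

lemma card_standard: "card standard = zeta2 S \<Lambda> \<epsilon>"
  by (simp add: standard_def zeta2_def)

lemma card_conditions: "card conditions = zeta1 S \<Lambda> \<epsilon>"
  unfolding conditions_def zeta1_def using finite_grid finite_B by (intro card_SigmaI) auto

lemma in_Q_iff: "f \<in> Q \<longleftrightarrow> (\<forall>(a, \<beta>)\<in>conditions. Poly_Mapping.lookup (translate a f) \<beta> = 0)"
  by (auto simp: Q_set_def conditions_def in_keys_iff subset_iff)

lemma grid_poly_in_Q: "l \<in> \<Lambda> \<Longrightarrow> g l \<in> Q"
  using grid_poly_in_point_ideal[OF finite_S] by (auto simp: Q_set_eq)

lemma D_set_image: "D_set S \<Lambda> \<epsilon> = theta S \<epsilon> ` \<Lambda>"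
  by (auto simp: D_set_def)

lemma grid_division:
  obtains p r where "f = (\<Sum>l\<in>\<Lambda>. p l * g l) + r" "supp r \<subseteq> standard"
    "\<And>l. l \<in> \<Lambda> \<Longrightarrow> supp (p l) + supp (g l) \<subseteq> down_closure (supp f)"
proof -
  obtain p r where "f = (\<Sum>l\<in>\<Lambda>. p l * g l) + r \<and>
      supp r \<subseteq> down_closure (supp f) - up_closure (theta S \<epsilon> ` \<Lambda>) \<and>
      (\<forall>l\<in>\<Lambda>. supp (p l) + supp (g l) \<subseteq> down_closure (supp f))"
    using division[OF finite_\<Lambda>, of g "theta S \<epsilon>" f, OF has_lead_grid_poly] by (elim exE) (rule that)
  then show thesis by (intro that[of p r]) (auto simp: standard_def D_set_image)
qed

lemma combination_in_Q: "(\<Sum>l\<in>\<Lambda>. p l * g l) \<in> Q"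
  by (intro ideal_sum ideal_mult Q_set_ideal grid_poly_in_Q)

lemma grid_poly_monic: "monic (g l)" and grid_poly_greatest_supp: "greatest_supp (g l) (theta S \<epsilon> l)"
  using has_lead_grid_poly[of S \<epsilon> l] has_lead_greatest_supp has_lead_lookup
  unfolding monic_def by blast+

text \<open>The leading exponent of \<open>g r\<close> is unique, so a violation of the Groebner
  property is a nonzero element of \<open>Q\<close> none of whose exponents lies above some
  \<open>theta S \<epsilon> l\<close>. In this form the property is the injectivity of the
  matrix.\<close>

lemma groebner_basis_iff:
  "groebner_basis \<Lambda> g Q \<longleftrightarrow> (\<forall>f\<in>Q. supp f \<subseteq> standard \<longrightarrow> f = 0)"
proof -
  have "greatest_supp (g r) \<theta> \<longleftrightarrow> \<theta> = theta S \<epsilon> r" for r \<theta>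
    using grid_poly_greatest_supp[of r] by (auto simp: greatest_supp_def intro: order_antisym)
  then have "groebner_basis \<Lambda> g Q \<longleftrightarrow> (\<forall>f\<in>Q - {0}. \<exists>\<alpha>\<in>supp f. \<exists>l\<in>\<Lambda>. theta S \<epsilon> l \<le> \<alpha>)"
    by (simp add: groebner_basis_def Q_set_ideal grid_poly_monic grid_poly_in_Q)
  also have "\<dots> \<longleftrightarrow> (\<forall>f\<in>Q - {0}. \<exists>\<alpha>\<in>supp f. \<alpha> \<notin> standard)"
    by (simp add: standard_def up_closure_def D_set_image)
  finally show ?thesis by blast
qed

section \<open>Coefficient vectors and the kernel of the matrix\<close>

definition vector_poly :: "('n expo \<Rightarrow> 'a) \<Rightarrow> ('n, 'a) mpoly" where
  "vector_poly x = (\<Sum>\<alpha>\<in>standard. Poly_Mapping.single \<alpha> (x \<alpha>))"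

lemma lookup_vector_poly:
  "Poly_Mapping.lookup (vector_poly x) \<alpha> = (if \<alpha> \<in> standard then x \<alpha> else 0)"
  by (simp add: vector_poly_def lookup_sum lookup_single when_def finite_standard)

lemma supp_vector_poly: "supp (vector_poly x) \<subseteq> standard"
  by (auto simp: in_keys_iff lookup_vector_poly split: if_splits)

lemma vector_poly_in_Q_iff:
  "vector_poly x \<in> Q \<longleftrightarrow> (\<forall>(a, \<beta>)\<in>conditions.
     (\<Sum>\<alpha>\<in>standard. Poly_Mapping.lookup (shifted_monomial a \<alpha>) \<beta> * x \<alpha>) = 0)"
  by (simp add: in_Q_iff lookup_translate[OF finite_standard supp_vector_poly] lookup_vector_poly)

lemma groebner_basis_kernel:
  assumes "groebner_basis \<Lambda> g Q"
    and "\<And>a \<beta>. (a, \<beta>) \<in> conditions \<Longrightarrow>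
      (\<Sum>\<alpha>\<in>standard. Poly_Mapping.lookup (shifted_monomial a \<alpha>) \<beta> * x \<alpha>) = 0"
    and "\<alpha> \<in> standard"
  shows "x \<alpha> = 0"
proof -
  have "vector_poly x \<in> Q" using assms(2) by (auto simp: vector_poly_in_Q_iff)
  then have "vector_poly x = 0" using assms(1) supp_vector_poly by (auto simp: groebner_basis_iff)
  then show ?thesis using lookup_vector_poly[of x \<alpha>] assms(3) by simp
qed

subsection \<open>Interpolation under Condition (D)\<close>

text \<open>Each axis carries infinitely many exponents and only finitely many are standard; the
  maximum over the finitely many axes serves them all.\<close>

lemma exists_uniform_power:
  "\<exists>N. \<forall>i. (\<lambda>j. if j = i then N else 0) \<in> up_closure (D_set S \<Lambda> \<epsilon>)"
proof -
  have "\<exists>N. (\<lambda>j. if j = i then N else 0) \<in> up_closure (D_set S \<Lambda> \<epsilon>)" for i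
  proof (rule ccontr)
    assume "\<not> ?thesis"
    then have "range (\<lambda>N j. if j = i then N else 0) \<subseteq> standard" by (auto simp: standard_def)
    moreover have "inj (\<lambda>N j. if j = i then N else (0::nat))"
      by (rule injI) (metis (full_types))
    ultimately show False using finite_standard by (meson finite_imageD finite_subset infinite_UNIV_nat)
  qed
  then obtain N where N: "\<And>i. (\<lambda>j. if j = i then N i else 0) \<in> up_closure (D_set S \<Lambda> \<epsilon>)"
    by metis
  have "(\<lambda>j. if j = i then Max (range N) else 0) \<in> up_closure (D_set S \<Lambda> \<epsilon>)" for i
    by (rule up_closure_mono[OF N[of i]]) (auto simp: le_fun_def)
  then show ?thesis by blast
qed

lemma linear_power_in_point_ideal:
  assumes "(\<lambda>j. if j = i then N else 0) \<in> up_closure C"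
  shows "(Var i - Const (a i)) ^ N \<in> point_ideal C a"
proof -
  have "(\<Prod>j\<in>UNIV. (Var j - Const (a j)) ^ (if j = i then N else 0)) = (Var i - Const (a i)) ^ N"
    by (simp add: if_distrib[of "power _"] cong: if_cong)
  then show ?thesis using point_ideal_single[OF assms, of a] by simp
qed

text \<open>Two distinct points differ in some coordinate \<open>i\<close>. High powers of the two
  linear factors in variable \<open>i\<close> lie in the respective ideals, and their constant
  difference is a non-zero-divisor by Condition (D), so \<open>power_comaximal\<close>
  applies.\<close>

lemma separating_poly:
  assumes D: "\<And>k. condition_D (S k)" and a: "a \<in> grid S" and b: "b \<in> grid S" "a \<noteq> b"
  shows "\<exists>P d. \<not> zero_divisor d \<and> P \<in> point_ideal (B b) b \<and> P - Const d \<in> point_ideal (B a) a"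
proof -
  obtain N where N: "\<And>i. (\<lambda>j. if j = i then N else 0) \<in> up_closure (D_set S \<Lambda> \<epsilon>)"
    using exists_uniform_power by blast
  obtain i where i: "a i \<noteq> b i" using b(2) by blast
  define c where "c = a i - b i"
  have "\<not> zero_divisor c"
    using D[of i] i a b unfolding condition_D_def c_def grid_def by (auto simp: PiE_iff)
  obtain P where P: "(Var i - Const (b i)) ^ N dvd P"
      "(Var i - Const (a i)) ^ N dvd P - Const c ^ (N * N)"
    using power_comaximal[of "Var i - Const (b i)" N "Var i - Const (a i)"]
    by (auto simp: c_def Const_diff)
  have "(Var i - Const (x i)) ^ N \<in> point_ideal (B x) x" if "x \<in> grid S" for x
    using N up_closure_D_subset[OF that] by (intro linear_power_in_point_ideal) auto
  with P a b have "P \<in> point_ideal (B b) b" "P - Const (c ^ (N * N)) \<in> point_ideal (B a) a"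
    by (auto simp: Const_power intro: ideal_dvd[OF point_ideal_ideal])
  with not_zero_divisor_power[OF \<open>\<not> zero_divisor c\<close>] show ?thesis by blast
qed

text \<open>The monomial at \<open>a\<close> with exponent \<alpha>, times separating polynomials
  for the other points, lies in all the other point ideals and is a constant multiple of that
  monomial modulo the ideal at \<open>a\<close>. Division changes it only by an element of
  \<open>Q\<close>, which leaves the conditions untouched.\<close>

lemma interpolation:
  assumes D: "\<And>k. condition_D (S k)" and a: "(a, \<alpha>) \<in> conditions"
  shows "\<exists>r d. \<not> zero_divisor d \<and> supp r \<subseteq> standard \<and>
    (\<forall>(b, \<beta>)\<in>conditions. Poly_Mapping.lookup (translate b r) \<beta> = (if (b, \<beta>) = (a, \<alpha>) then d else 0))"
proof -
  have aS: "a \<in> grid S" using a by (auto simp: conditions_def)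
  obtain P d where P: "\<And>b. b \<in> grid S - {a} \<Longrightarrow> \<not> zero_divisor (d b)"
      "\<And>b. b \<in> grid S - {a} \<Longrightarrow> P b \<in> point_ideal (B b) b"
      "\<And>b. b \<in> grid S - {a} \<Longrightarrow> P b - Const (d b) \<in> point_ideal (B a) a"
    using separating_poly[OF D aS] by (metis Diff_iff insertCI)
  define m where "m = (\<Prod>i\<in>UNIV. (Var i - Const (a i)) ^ \<alpha> i)"
  define c where "c = (\<Prod>b\<in>grid S - {a}. d b)"
  define f where "f = m * (\<Prod>b\<in>grid S - {a}. P b)"
  obtain p r where r: "f = (\<Sum>l\<in>\<Lambda>. p l * g l) + r" "supp r \<subseteq> standard"
    using grid_division[of f] by metis
  have fr: "f - r \<in> point_ideal (B b) b" if "b \<in> grid S" for b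
    using combination_in_Q[of p] r(1) that by (auto simp: Q_set_eq)
  have outside: "Poly_Mapping.lookup (translate b h) \<beta> = 0"
    if "h \<in> point_ideal (B b) b" "(b, \<beta>) \<in> conditions" for h b \<beta>
    using that by (auto simp: point_ideal_def conditions_def in_keys_iff)
  have "Poly_Mapping.lookup (translate b r) \<beta> = (if (b, \<beta>) = (a, \<alpha>) then c else 0)"
    if b: "(b, \<beta>) \<in> conditions" for b \<beta>
  proof (cases "b = a")
    case True
    \<comment> \<open>Modulo the ideal at \<open>a\<close> each \<open>P b\<close> may be replaced
      by the constant \<open>d b\<close>.\<close>
    have "m * ((\<Prod>b\<in>grid S - {a}. P b) - (\<Prod>b\<in>grid S - {a}. Const (d b))) \<in> point_ideal (B a) a"
      by (intro ideal_mult ideal_prod_diff point_ideal_ideal P(3))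
    then have "f - Const c * m \<in> point_ideal (B a) a"
      by (simp add: f_def c_def Const_prod algebra_simps)
    then have "(f - Const c * m) - (f - r) \<in> point_ideal (B a) a"
      by (rule ideal_diff[OF point_ideal_ideal _ fr[OF aS]])
    then have "Poly_Mapping.lookup (translate a (r - Const c * m)) \<beta> = 0"
      using outside b True by simp
    moreover have "translate a r = translate a (r - Const c * m) + translate a (Const c * m)"
      by (simp flip: translate_add)
    moreover have "translate a (Const c * m) = Const c * Poly_Mapping.single \<alpha> 1"
      by (simp add: m_def translate_mult translate_Const translate_prod translate_power
          translate_linear prod_Var_power)
    ultimately show ?thesis
      using True by (auto simp: lookup_add lookup_Const_mult lookup_single when_def)
  next
    case False
    have bS: "b \<in> grid S" using b by (auto simp: conditions_def)
    have "P b dvd f"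
      unfolding f_def using finite_grid bS False dvd_prodI[of "grid S - {a}" b P]
      by (intro dvd_mult) simp
    moreover have "P b \<in> point_ideal (B b) b" using bS False by (intro P(2)) simp
    ultimately have "f \<in> point_ideal (B b) b" by (rule ideal_dvd[OF point_ideal_ideal, rotated])
    then have "f - (f - r) \<in> point_ideal (B b) b"
      by (rule ideal_diff[OF point_ideal_ideal _ fr[OF bS]])
    then show ?thesis using outside b False by auto
  qed
  moreover have "\<not> zero_divisor c"
    unfolding c_def using P(1) by (intro not_zero_divisor_prod)
  ultimately show ?thesis using r(2) by blast
qed

text \<open>The coefficient vectors of the \<open>r i\<close> are the columns of a right inverse of
  the matrix, up to the diagonal \<open>d\<close>.\<close>

lemma interpolation_family:
  assumes "\<And>k. condition_D (S k)"
  shows "\<exists>r d. \<forall>i\<in>conditions. \<not> zero_divisor (d i) \<and> supp (r i) \<subseteq> standard \<and>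
    (\<forall>(b, \<beta>)\<in>conditions. Poly_Mapping.lookup (translate b (r i)) \<beta> = (if (b, \<beta>) = i then d i else 0))"
proof -
  have "\<forall>i\<in>conditions. \<exists>x. \<not> zero_divisor (snd x) \<and> supp (fst x) \<subseteq> standard \<and>
    (\<forall>(b, \<beta>)\<in>conditions. Poly_Mapping.lookup (translate b (fst x)) \<beta> = (if (b, \<beta>) = i then snd x else 0))"
    (is "\<forall>i\<in>_. ?P i")
  proof
    fix i assume i: "i \<in> conditions"
    obtain a \<alpha> where "i = (a, \<alpha>)" by (cases i)
    with interpolation[OF assms, of a \<alpha>] i show "?P i" by (simp only: split_paired_Ex fst_conv snd_conv)
  qed
  from bchoice[OF this] show ?thesis
    by (elim exE) (rule exI[of _ "\<lambda>i. fst (x i)" for x], rule exI[of _ "\<lambda>i. snd (x i)" for x])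
qed

section \<open>Comparison of the two counts, and the square case\<close>

text \<open>With more conditions than standard exponents, the interpolating polynomials would
  satisfy a nontrivial linear relation \<open>y\<close>; condition \<open>j\<close> applied to it
  isolates \<open>y j * d j\<close>, which forces \<open>y j = 0\<close>.\<close>

lemma zeta1_le_zeta2_condition_D:
  assumes "\<And>k. condition_D (S k)"
  shows "zeta1 S \<Lambda> \<epsilon> \<le> zeta2 S \<Lambda> \<epsilon>"
proof (rule ccontr)
  assume "\<not> ?thesis"
  then have card: "card standard < card conditions"
    by (simp add: card_standard card_conditions)
  obtain r d where family: "\<forall>i\<in>conditions. \<not> zero_divisor (d i) \<and> supp (r i) \<subseteq> standard \<and>
    (\<forall>(b, \<beta>)\<in>conditions. Poly_Mapping.lookup (translate b (r i)) \<beta> = (if (b, \<beta>) = i then d i else 0))"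
    using interpolation_family[OF assms] by (elim exE) (rule that)
  then have rd: "\<And>i. i \<in> conditions \<Longrightarrow> \<not> zero_divisor (d i)"
    "\<And>i. i \<in> conditions \<Longrightarrow> supp (r i) \<subseteq> standard"
    by simp_all
  have rd3: "Poly_Mapping.lookup (translate b (r i)) \<beta> = (if (b, \<beta>) = i then d i else 0)"
    if "i \<in> conditions" "(b, \<beta>) \<in> conditions" for i b \<beta>
    using bspec[OF conjunct2[OF conjunct2[OF bspec[OF family that(1)]]] that(2)] by simp
  obtain y where y: "\<exists>i\<in>conditions. y i \<noteq> 0"
      "\<forall>\<alpha>\<in>standard. (\<Sum>i\<in>conditions. Poly_Mapping.lookup (r i) \<alpha> * y i) = 0"
    using linear_system_nontrivial_solution[OF finite_standard finite_conditions card,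
        of 1 "\<lambda>\<alpha> i. Poly_Mapping.lookup (r i) \<alpha>"] by auto
  \<comment> \<open>All \<open>r i\<close> are supported on \<open>standard\<close>, so a relation
    between the standard coefficients is a relation between polynomials.\<close>
  have "(\<Sum>i\<in>conditions. Const (y i) * r i) = 0"
  proof (rule poly_mapping_eqI)
    fix \<alpha>
    show "Poly_Mapping.lookup (\<Sum>i\<in>conditions. Const (y i) * r i) \<alpha> = Poly_Mapping.lookup 0 \<alpha>"
    proof (cases "\<alpha> \<in> standard")
      case True
      then show ?thesis using y(2) by (simp add: lookup_sum lookup_Const_mult) (simp add: mult.commute)
    next
      case False
      then have "Poly_Mapping.lookup (r i) \<alpha> = 0" if "i \<in> conditions" for i
        using rd(2)[OF that] by (metis in_keys_iff subsetD)
      then show ?thesis by (simp add: lookup_sum lookup_Const_mult)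
    qed
  qed
  then have "translate b (\<Sum>i\<in>conditions. Const (y i) * r i) = 0" for b
    by (simp only: translate_0)
  then have zero: "(\<Sum>i\<in>conditions. Const (y i) * translate b (r i)) = 0" for b
    by (simp add: translate_sum translate_mult translate_Const)
  have "y j = 0" if j: "j \<in> conditions" for j
  proof -
    obtain b \<beta> where b: "j = (b, \<beta>)" by (cases j)
    have "0 = (\<Sum>i\<in>conditions. y i * Poly_Mapping.lookup (translate b (r i)) \<beta>)"
      using arg_cong[OF zero[of b], of "\<lambda>h. Poly_Mapping.lookup h \<beta>"]
      by (simp add: lookup_sum lookup_Const_mult)
    also have "\<dots> = (\<Sum>i\<in>conditions. if j = i then y i * d i else 0)"
      using rd3 j b by (intro sum.cong) auto
    also have "\<dots> = y j * d j" using j finite_conditions by simp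
    finally show ?thesis using rd(1)[OF j] by (metis mult.commute zero_divisor_def)
  qed
  with y(1) show False by blast
qed

text \<open>The right inverse only shows that the transposed matrix has trivial kernel;
  \<open>square_kernel_transpose\<close> carries this over to the matrix itself.\<close>

lemma groebner_basis_condition_D:
  assumes zeta: "zeta1 S \<Lambda> \<epsilon> = zeta2 S \<Lambda> \<epsilon>" and D: "\<And>k. condition_D (S k)"
  shows "groebner_basis \<Lambda> g Q"
  unfolding groebner_basis_iff
proof (intro ballI impI, rule ccontr)
  fix f assume f: "f \<in> Q" "supp f \<subseteq> standard" "f \<noteq> 0"
  define A where "A = (\<lambda>(a :: 'n \<Rightarrow> 'a, \<beta>) \<alpha>. Poly_Mapping.lookup (shifted_monomial a \<alpha>) \<beta>)"
  have A: "Poly_Mapping.lookup (translate a h) \<beta>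
      = (\<Sum>\<alpha>\<in>standard. A (a, \<beta>) \<alpha> * Poly_Mapping.lookup h \<alpha>)"
    if "supp h \<subseteq> standard" for h a \<beta>
    by (simp add: A_def lookup_translate[OF finite_standard that])
  have "\<exists>\<alpha>\<in>standard. Poly_Mapping.lookup f \<alpha> \<noteq> 0"
    using f(2,3) by (metis in_keys_iff keys_eq_empty subset_empty subset_iff)
  moreover have "\<forall>i\<in>conditions. (\<Sum>\<alpha>\<in>standard. A i \<alpha> * Poly_Mapping.lookup f \<alpha>) = 0"
    using f(1,2) A by (auto simp: in_Q_iff)
  ultimately obtain y where y: "\<exists>i\<in>conditions. y i \<noteq> 0"
      "\<forall>\<alpha>\<in>standard. (\<Sum>i\<in>conditions. A i \<alpha> * y i) = 0"
    using square_kernel_transpose[OF finite_conditions finite_standard, of "Poly_Mapping.lookup f" A] zeta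
    by (auto simp: card_standard card_conditions)
  obtain r d where family: "\<forall>i\<in>conditions. \<not> zero_divisor (d i) \<and> supp (r i) \<subseteq> standard \<and>
    (\<forall>(b, \<beta>)\<in>conditions. Poly_Mapping.lookup (translate b (r i)) \<beta> = (if (b, \<beta>) = i then d i else 0))"
    using interpolation_family[OF D] by (elim exE) (rule that)
  then have rd: "\<And>i. i \<in> conditions \<Longrightarrow> \<not> zero_divisor (d i)"
    "\<And>i. i \<in> conditions \<Longrightarrow> supp (r i) \<subseteq> standard"
    by simp_all
  have rd3: "Poly_Mapping.lookup (translate b (r i)) \<beta> = (if (b, \<beta>) = i then d i else 0)"
    if "i \<in> conditions" "(b, \<beta>) \<in> conditions" for i b \<beta>
    using bspec[OF conjunct2[OF conjunct2[OF bspec[OF family that(1)]]] that(2)] by simp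
  have "y j = 0" if j: "j \<in> conditions" for j
  proof -
    \<comment> \<open>The pairing of \<open>y\<close> with the image of \<open>r j\<close> is
      evaluated in two ways: by interpolation it is \<open>y j * d j\<close>, and after exchanging
      the sums it vanishes.\<close>
    have "y j * d j = (\<Sum>i\<in>conditions. if i = j then y i * d j else 0)"
      using j finite_conditions by simp
    also have "\<dots> = (\<Sum>i\<in>conditions. y i * (\<Sum>\<alpha>\<in>standard. A i \<alpha> * Poly_Mapping.lookup (r j) \<alpha>))"
      using rd3[OF j] A[OF rd(2)[OF j]] by (intro sum.cong) auto
    also have "\<dots> = (\<Sum>i\<in>conditions. \<Sum>\<alpha>\<in>standard. Poly_Mapping.lookup (r j) \<alpha> * (A i \<alpha> * y i))"
      by (simp add: sum_distrib_left ac_simps)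
    also have "\<dots> = (\<Sum>\<alpha>\<in>standard. Poly_Mapping.lookup (r j) \<alpha> * (\<Sum>i\<in>conditions. A i \<alpha> * y i))"
      by (subst sum.swap) (simp add: sum_distrib_left)
    finally have "d j * y j = 0" using y(2) by (simp add: mult.commute)
    then show ?thesis using rd(1)[OF j] by (auto simp: zero_divisor_def)
  qed
  with y(1) show False by blast
qed

section \<open>Representations of elements of the ideal\<close>

text \<open>The remainder of division lies in \<open>Q\<close> and is supported on
  \<open>standard\<close>, hence it is zero.\<close>

lemma groebner_basis_combination:
  assumes "groebner_basis \<Lambda> g Q" "f \<in> Q"
  shows "\<exists>p. f = (\<Sum>l\<in>\<Lambda>. p l * g l) \<and>
    (\<forall>l\<in>\<Lambda>. supp (p l) + supp (g l) \<subseteq> down_closure (supp f))"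
proof (rule grid_division[of f])
  fix p r
  assume r: "f = (\<Sum>l\<in>\<Lambda>. p l * g l) + r" "supp r \<subseteq> standard"
    "\<And>l. l \<in> \<Lambda> \<Longrightarrow> supp (p l) + supp (g l) \<subseteq> down_closure (supp f)"
  have "f - (\<Sum>l\<in>\<Lambda>. p l * g l) \<in> Q"
    by (intro ideal_diff Q_set_ideal combination_in_Q assms)
  then have "r \<in> Q" using r(1) by simp
  then have "r = 0" using assms(1) r(2) by (simp add: groebner_basis_iff)
  with r show ?thesis by (intro exI[of _ p]) simp
qed

text \<open>The exponent \<beta> occurs in some \<open>p l * g l\<close>. Exchanging its part from
  \<open>g l\<close> for \<open>theta S \<epsilon> l\<close> gives a larger or equal exponent, still
  below one of \<open>supp f\<close>; maximality makes the latter equal to \<beta>.\<close>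

lemma max_elems_ge_theta:
  assumes f: "f = (\<Sum>l\<in>\<Lambda>. p l * g l)"
    "\<And>l. l \<in> \<Lambda> \<Longrightarrow> supp (p l) + supp (g l) \<subseteq> down_closure (supp f)"
    and \<beta>: "\<beta> \<in> max_elems (supp f)"
  shows "\<exists>l\<in>\<Lambda>. theta S \<epsilon> l \<le> \<beta>"
proof -
  from \<beta> have "\<beta> \<in> supp f" by (simp add: max_elems_def)
  then have "\<beta> \<in> supp (\<Sum>l\<in>\<Lambda>. p l * g l)" by (simp flip: f(1))
  then obtain l where l: "l \<in> \<Lambda>" "\<beta> \<in> supp (p l * g l)"
    using keys_sum_subset[of "\<lambda>l. p l * g l" \<Lambda>] by auto
  then obtain \<mu> \<nu> where \<mu>: "\<beta> = \<mu> + \<nu>" "\<mu> \<in> supp (p l)" "\<nu> \<in> supp (g l)"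
    using keys_mult[of "p l" "g l"] by auto
  have \<theta>: "theta S \<epsilon> l \<in> supp (g l)" "\<nu> \<le> theta S \<epsilon> l"
    using grid_poly_greatest_supp[of l] \<mu>(3) by (auto simp: greatest_supp_def)
  then have "\<mu> + theta S \<epsilon> l \<in> down_closure (supp f)"
    using f(2)[OF l(1)] \<mu>(2) by (auto simp: set_plus_def)
  then obtain \<alpha> where \<alpha>: "\<alpha> \<in> supp f" "\<mu> + theta S \<epsilon> l \<le> \<alpha>"
    by (auto simp: down_closure_def)
  have "\<beta> \<le> \<mu> + theta S \<epsilon> l" using \<mu>(1) \<theta>(2) by (simp add: add_left_mono)
  then have "\<beta> = \<alpha>" using \<alpha> \<beta> by (auto simp: max_elems_def intro: order_trans)
  moreover have "theta S \<epsilon> l \<le> \<mu> + theta S \<epsilon> l" by (simp add: le_fun_def)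
  ultimately show ?thesis using \<alpha>(2) l(1) by (auto intro: order_trans)
qed

subsection \<open>Necessity\<close>

text \<open>With fewer rows than columns the matrix has a nonzero kernel vector, even over a ring
  with zero divisors; \<open>c = 1\<close> gives its plain existence.\<close>

lemma zeta2_le_zeta1:
  assumes "groebner_basis \<Lambda> g Q"
  shows "zeta2 S \<Lambda> \<epsilon> \<le> zeta1 S \<Lambda> \<epsilon>"
proof (rule ccontr)
  assume "\<not> ?thesis"
  then have "card conditions < card standard"
    by (simp add: card_standard card_conditions)
  from linear_system_nontrivial_solution[OF finite_conditions finite_standard this, of 1
      "\<lambda>(a, \<beta>) \<alpha>. Poly_Mapping.lookup (shifted_monomial a \<alpha>) \<beta>"]
  obtain x where "\<exists>\<alpha>\<in>standard. x \<alpha> \<noteq> 0"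
      "\<forall>(a, \<beta>)\<in>conditions. (\<Sum>\<alpha>\<in>standard. Poly_Mapping.lookup (shifted_monomial a \<alpha>) \<beta> * x \<alpha>) = 0"
    by (auto simp: case_prod_beta)
  with groebner_basis_kernel[OF assms, of x] show False by blast
qed

text \<open>The two numbers only depend on the multiplicities, so the grid may be replaced by an
  integer one, for which Condition (D) is automatic.\<close>

lemma zeta1_le_zeta2: "zeta1 S \<Lambda> \<epsilon> \<le> zeta2 S \<Lambda> \<epsilon>"
proof -
  have "\<exists>h :: 'a \<Rightarrow> int. inj_on h (S i)" for i
  proof -
    obtain e :: "'a \<Rightarrow> nat" where "inj_on e (S i)"
      using finite_imp_inj_to_nat_seg[OF finite_S] by metis
    then have "inj_on (\<lambda>u. of_nat (e u) :: int) (S i)" by (simp add: inj_on_def)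
    then show ?thesis by blast
  qed
  then obtain h :: "'n \<Rightarrow> 'a \<Rightarrow> int" where h: "\<And>i. inj_on (h i) (S i)" by metis
  define S' where "S' i = h i ` S i" for i
  \<comment> \<open>Multiplicities are carried along the injections, so that \<theta> and the sets
    \<open>B_set\<close> at corresponding points agree.\<close>
  define \<epsilon>' where "\<epsilon>' i v = \<epsilon> i (the_inv_into (S i) (h i) v)" for i v
  have \<epsilon>': "\<epsilon>' i (h i u) = \<epsilon> i u" if "u \<in> S i" for i u
    using that h by (simp add: \<epsilon>'_def the_inv_into_f_f)
  have theta: "theta S' \<epsilon>' l = theta S \<epsilon> l" for l
    using \<epsilon>' by (auto simp: theta_def S'_def sum.reindex[OF h] intro!: ext sum.cong)
  then have D: "D_set S' \<Lambda> \<epsilon>' = D_set S \<Lambda> \<epsilon>" by (simp add: D_set_def)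
  \<comment> \<open>The induced relabelling of grid points, along which the sum defining
    \<open>zeta1\<close> is reindexed.\<close>
  define T where "T a i = h i (a i)" for a i
  have "bij_betw T (grid S) (grid S')"
  proof (rule bij_betw_imageI)
    show "inj_on T (grid S)"
    proof (rule inj_onI, rule ext)
      fix a b i assume "a \<in> grid S" "b \<in> grid S" "T a = T b"
      then show "a i = b i"
        using inj_onD[OF h[of i], of "a i" "b i"] by (auto simp: grid_def PiE_iff T_def fun_eq_iff)
    qed
    show "T ` grid S = grid S'"
    proof
      show "T ` grid S \<subseteq> grid S'" by (auto simp: grid_def PiE_iff T_def S'_def)
      show "grid S' \<subseteq> T ` grid S"
      proof
        fix b assume "b \<in> grid S'"
        then have "\<forall>i. \<exists>u\<in>S i. b i = h i u" by (auto simp: grid_def PiE_iff S'_def)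
        then obtain a where "\<And>i. a i \<in> S i" "\<And>i. b i = h i (a i)" by metis
        then show "b \<in> T ` grid S"
          by (intro image_eqI[of _ _ a]) (auto simp: grid_def PiE_iff T_def)
      qed
    qed
  qed
  moreover have "B_set \<Lambda> \<epsilon>' (T a) = B_set \<Lambda> \<epsilon> a" if "a \<in> grid S" for a
    using that \<epsilon>' by (auto simp: B_set_def T_def grid_def PiE_iff)
  ultimately have "zeta1 S' \<Lambda> \<epsilon>' = zeta1 S \<Lambda> \<epsilon>"
    unfolding zeta1_def by (subst sum.reindex_bij_betw[symmetric]) auto
  moreover have "zeta2 S' \<Lambda> \<epsilon>' = zeta2 S \<Lambda> \<epsilon>" by (simp add: zeta2_def D)
  moreover interpret integral: grid_data S' \<Lambda> \<epsilon>'
    by unfold_locales (use finite_S finite_\<Lambda> finite_D D in \<open>auto simp: S'_def\<close>)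
  have "condition_D (S' k)" for k by (simp add: condition_D_def zero_divisor_def)
  then have "zeta1 S' \<Lambda> \<epsilon>' \<le> zeta2 S' \<Lambda> \<epsilon>'" by (rule integral.zeta1_le_zeta2_condition_D)
  ultimately show ?thesis by simp
qed

text \<open>Congruence modulo the annihilator of \<open>Const c\<close> is compatible with
  powers.\<close>

lemma Const_mult_power_cong:
  assumes "Const c * p = Const c * q"
  shows "Const c * p ^ k = Const c * q ^ k"
proof (induction k)
  case (Suc k)
  have "Const c * p ^ Suc k = p * (Const c * p ^ k)" by (simp add: ac_simps)
  also have "\<dots> = (Const c * p) * q ^ k" by (simp add: Suc ac_simps)
  also have "\<dots> = Const c * q ^ Suc k" by (simp only: assms power_Suc mult.assoc)
  finally show ?case .
qed simp

text \<open>If \<open>c (b - a) = 0\<close>, two rows of the matrix agree after multiplication by \<open>c\<close>. Every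
  solution in multiples of \<open>c\<close> of the system without one of these rows solves the whole system.\<close>

lemma groebner_basis_imp_condition_D:
  assumes "groebner_basis \<Lambda> g Q" and "grid S \<noteq> {}" and B0: "\<And>a. a \<in> grid S \<Longrightarrow> 0 \<notin> B a"
  shows "condition_D (S k)"
  unfolding condition_D_def
proof (intro ballI impI notI)
  fix u v assume uv: "u \<in> S k" "v \<in> S k" "u \<noteq> v" and "zero_divisor (v - u)"
  then obtain c where c: "c \<noteq> 0" "c * u = c * v"
    by (auto simp: zero_divisor_def algebra_simps)
  obtain a0 where "a0 \<in> grid S" using \<open>grid S \<noteq> {}\<close> by blast
  then have a: "a0(k := w) \<in> grid S" if "w \<in> S k" for w
    using that by (auto simp: grid_def PiE_iff)
  \<comment> \<open>Only 0 lies below 0, so \<open>B0\<close> keeps 0 out of the up-closure: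
    vanishing at each of these points is one of the conditions.\<close>
  have row: "(a0(k := w), 0) \<in> conditions" if "w \<in> S k" for w
  proof -
    have "\<beta> = 0" if "\<beta> \<le> (0 :: 'n expo)" for \<beta> using that by (auto simp: le_fun_def fun_eq_iff)
    then show ?thesis using B0[OF a[OF that]] a[OF that] by (auto simp: conditions_def up_closure_def)
  qed
  have eq: "Const c * shifted_monomial (a0(k := u)) \<alpha> = Const c * shifted_monomial (a0(k := v)) \<alpha>" for \<alpha>
  proof -
    \<comment> \<open>Only the factor of variable \<open>k\<close> depends on the altered
      coordinate.\<close>
    have split: "Const c * shifted_monomial (a0(k := w)) \<alpha>
        = (Const c * (Var k + Const w) ^ \<alpha> k) * (\<Prod>i\<in>UNIV - {k}. (Var i + Const (a0 i)) ^ \<alpha> i)" for w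
      by (subst prod.remove[of _ k]) (auto simp: mult.assoc intro!: arg_cong[of _ _ "(*) _"] prod.cong)
    have "Const c * (Var k + Const u) = Const c * (Var k + Const v)"
      by (simp add: distrib_left c(2) flip: Const_mult)
    from Const_mult_power_cong[OF this, of "\<alpha> k"] show ?thesis by (simp only: split)
  qed
  have "a0(k := u) \<noteq> a0(k := v)" using uv by (metis fun_upd_same)
  define I where "I = conditions - {(a0(k := v), 0)}"
  \<comment> \<open>By the general inequality, deleting a single row already leaves fewer rows than
    columns.\<close>
  have "zeta1 S \<Lambda> \<epsilon> \<le> zeta2 S \<Lambda> \<epsilon>" by (rule zeta1_le_zeta2)
  then have "card I < card standard"
    using row[OF uv(2)] finite_conditions card_Diff1_less[of conditions "(a0(k := v), 0)"]
    by (simp add: I_def card_standard card_conditions del: card_Diff_insert)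
  moreover have "finite I" using finite_conditions by (simp add: I_def)
  ultimately obtain x where x: "\<forall>\<alpha>\<in>standard. c dvd x \<alpha>" "\<exists>\<alpha>\<in>standard. x \<alpha> \<noteq> 0"
      "\<forall>(a, \<beta>)\<in>I. (\<Sum>\<alpha>\<in>standard. Poly_Mapping.lookup (shifted_monomial a \<alpha>) \<beta> * x \<alpha>) = 0"
    using linear_system_nontrivial_solution[of I standard c
        "\<lambda>(a, \<beta>) \<alpha>. Poly_Mapping.lookup (shifted_monomial a \<alpha>) \<beta>"] finite_standard c(1)
    by (auto simp: case_prod_beta)
  have "Poly_Mapping.lookup (shifted_monomial (a0(k := v)) \<alpha>) 0 * x \<alpha>
      = Poly_Mapping.lookup (shifted_monomial (a0(k := u)) \<alpha>) 0 * x \<alpha>" if \<alpha>: "\<alpha> \<in> standard" for \<alpha>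
  proof -
    from x(1) \<alpha> obtain z where z: "x \<alpha> = c * z" by (auto elim: dvdE)
    have c_row: "c * Poly_Mapping.lookup (shifted_monomial (a0(k := v)) \<alpha>) 0
        = c * Poly_Mapping.lookup (shifted_monomial (a0(k := u)) \<alpha>) 0"
      by (simp only: lookup_Const_mult[symmetric] eq)
    have "Poly_Mapping.lookup (shifted_monomial (a0(k := v)) \<alpha>) 0 * x \<alpha>
        = (c * Poly_Mapping.lookup (shifted_monomial (a0(k := v)) \<alpha>) 0) * z"
      unfolding z by (simp only: ac_simps)
    also have "\<dots> = Poly_Mapping.lookup (shifted_monomial (a0(k := u)) \<alpha>) 0 * x \<alpha>"
      unfolding z c_row by (simp only: ac_simps)
    finally show ?thesis .
  qed
  then have "(\<Sum>\<alpha>\<in>standard. Poly_Mapping.lookup (shifted_monomial (a0(k := v)) \<alpha>) 0 * x \<alpha>)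
      = (\<Sum>\<alpha>\<in>standard. Poly_Mapping.lookup (shifted_monomial (a0(k := u)) \<alpha>) 0 * x \<alpha>)"
    by (intro sum.cong) auto
  also have "\<dots> = 0"
    using x(3) row[OF uv(1)] \<open>a0(k := u) \<noteq> a0(k := v)\<close> unfolding I_def by blast
  finally have "(\<Sum>\<alpha>\<in>standard. Poly_Mapping.lookup (shifted_monomial a \<alpha>) \<beta> * x \<alpha>) = 0"
    if "(a, \<beta>) \<in> conditions" for a \<beta>
    using that x(3) by (cases "(a, \<beta>) \<in> I") (auto simp: I_def)
  from groebner_basis_kernel[OF assms(1) this] x(2) show False by blast
qed

end

theorem theorem5p1:
  fixes S :: "'n::finite \<Rightarrow> 'a::comm_ring_1 set"
    and \<Lambda> :: "'l set"
    and \<epsilon> :: "'n \<Rightarrow> 'a \<Rightarrow> 'l \<Rightarrow> nat"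
  assumes "\<And>i. finite (S i)"
    and "finite \<Lambda>"
    and "finite (UNIV - up_closure (D_set S \<Lambda> \<epsilon>))"
  shows
    "(\<forall>l\<in>\<Lambda>. monic (grid_poly S \<epsilon> l) \<and> greatest_supp (grid_poly S \<epsilon> l) (theta S \<epsilon> l) \<and>
        grid_poly S \<epsilon> l \<in> Q_set S \<Lambda> \<epsilon>)
     \<and>
     (zeta1 S \<Lambda> \<epsilon> = zeta2 S \<Lambda> \<epsilon> \<and> (\<forall>k. condition_D (S k)) \<longrightarrow>
        groebner_basis \<Lambda> (grid_poly S \<epsilon>) (Q_set S \<Lambda> \<epsilon>) \<and>
        (\<forall>f\<in>Q_set S \<Lambda> \<epsilon>.
           (\<exists>p :: 'l \<Rightarrow> ('n, 'a) mpoly.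
              f = (\<Sum>l\<in>\<Lambda>. p l * grid_poly S \<epsilon> l) \<and>
              (\<forall>l\<in>\<Lambda>. supp (p l) + supp (grid_poly S \<epsilon> l) \<subseteq> down_closure (supp f))) \<and>
           (\<forall>\<beta>\<in>max_elems (supp f). \<exists>l\<in>\<Lambda>. \<forall>k. (\<Sum>u\<in>S k. \<epsilon> k u l) \<le> \<beta> k)))
     \<and>
     (grid S \<noteq> {} \<and> (\<forall>a\<in>grid S. 0 \<notin> B_set \<Lambda> \<epsilon> a) \<longrightarrow>
        (groebner_basis \<Lambda> (grid_poly S \<epsilon>) (Q_set S \<Lambda> \<epsilon>) \<longleftrightarrow>
           zeta1 S \<Lambda> \<epsilon> = zeta2 S \<Lambda> \<epsilon> \<and> (\<forall>k. condition_D (S k))))"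
proof -
  interpret grid_data S \<Lambda> \<epsilon>
    using assms by unfold_locales
  have "(\<exists>p. f = (\<Sum>l\<in>\<Lambda>. p l * g l) \<and> (\<forall>l\<in>\<Lambda>. supp (p l) + supp (g l) \<subseteq> down_closure (supp f))) \<and>
      (\<forall>\<beta>\<in>max_elems (supp f). \<exists>l\<in>\<Lambda>. \<forall>k. (\<Sum>u\<in>S k. \<epsilon> k u l) \<le> \<beta> k)"
    if "groebner_basis \<Lambda> g Q" "f \<in> Q" for f
  proof -
    from groebner_basis_combination[OF that]
    obtain p where p: "f = (\<Sum>l\<in>\<Lambda>. p l * g l)"
      "\<forall>l\<in>\<Lambda>. supp (p l) + supp (g l) \<subseteq> down_closure (supp f)"
      by (elim exE conjE) (rule that)
    have "\<forall>\<beta>\<in>max_elems (supp f). \<exists>l\<in>\<Lambda>. theta S \<epsilon> l \<le> \<beta>"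
      using max_elems_ge_theta[OF p(1)] p(2) by simp
    with p show ?thesis
      unfolding theta_def le_fun_def by (intro conjI exI[of _ p])
  qed
  moreover have "zeta1 S \<Lambda> \<epsilon> = zeta2 S \<Lambda> \<epsilon>" if "groebner_basis \<Lambda> g Q"
    using zeta1_le_zeta2 zeta2_le_zeta1[OF that] by simp
  ultimately show ?thesis
    using grid_poly_monic grid_poly_greatest_supp grid_poly_in_Q
      groebner_basis_condition_D groebner_basis_imp_condition_D
    by blast
qed

end
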